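(* Let $d \geq 2$ be an integer, let $\mu$ be a probability measure on $[0,\infty)$ with $\mu(\{0\})<1$, and let $\rho$ be a random variable with distribution $\mu$. If $\mathbb{E}[\rho^d] < \infty$, then the vacancy critical value $\lambda_c^*$ of the spherical Poisson Boolean model in $\mathbb{R}^d$ with radius distribution $\mu$ satisfies $\lambda_c^* > 0$.
   Context: For $\lambda \in (0,\infty)$, let $\mathcal{P}_\lambda = \{y_k : k \in \mathbb{N}\}$ be a homogeneous Poisson point process in $\mathbb{R}^d$ of intensity $\lambda$ (viewed as a random subset of $\mathbb{R}^d$, enumerated in order of increasing distance from the origin), and let $\rho,\rho_1,\rho_2,\ldots$ be independent random variables with common distribution $\mu$, independent of $\mathcal{P}_\lambda$. For $x\in\mathbb{R}^d$, $r \ge 0$ let $B(x,r) = \{y\in\mathbb{R}^d : \|y-x\|\le r\}$ (Euclidean norm). The occupied and vacant regions of the spherical Poisson Boolean model are $$Z_\lambda = \bigcup_{k} B(y_k,\rho_k), \qquad Z_\lambda^* = \mathbb{R}^d\setminus Z_\lambda .$$ A set percolates if it has an unbounded connected component. Let $U_\lambda^*$ be the event that $Z_\lambda^*$ percolates. One has $\mathbb{P}[U^*_\lambda]\in\{0,1\}$ by ergodicity, and $\mathbb{P}[U^*_\lambda]$ is decreasing in $\lambda$. Define $$\lambda_c^* := \inf\{\lambda>0 : \mathbb{P}[U_\lambda^*]=0\}.$$ *)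

theory Defs
  imports "HOL-Probability.Probability"
begin

text \<open>
  A random set is a Poisson process if it is locally finite and its counts over bounded Borel
  sets are Poisson distributed and, over disjoint sets, independent. The Poisson weights are
  spelled out because \<^term>\<open>poisson_pmf\<close> is only specified for positive rates, whereas sets of
  volume 0 (with \<^term>\<open>0 ^ 0 = (1::real)\<close> in the formula) are included here.
  Local finiteness ensures that the value 0 of \<^term>\<open>card\<close> on infinite sets is irrelevant.
\<close>

locale homogeneous_poisson_process = prob_space M
  for M :: "'w measure" +
  fixes intensity :: real
    and P :: "'w \<Rightarrow> 'a::euclidean_space set"
  assumes intensity_pos: "0 < intensity"
    and locally_finite: "AE \<omega> in M. \<forall>B. bounded B \<longrightarrow> finite (P \<omega> \<inter> B)"
    and count_measurable:
      "\<And>B. B \<in> sets borel \<Longrightarrow> bounded B \<Longrightarrow>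
        (\<lambda>\<omega>. card (P \<omega> \<inter> B)) \<in> measurable M (count_space UNIV)"
    and count_poisson:
      "\<And>B n. B \<in> sets borel \<Longrightarrow> bounded B \<Longrightarrow>
        prob {\<omega> \<in> space M. card (P \<omega> \<inter> B) = n} =
          (intensity * measure lborel B) ^ n / fact n * exp (- (intensity * measure lborel B))"
    and count_indep:
      "\<And>(A :: nat \<Rightarrow> 'a set) n.
        (\<And>i. i < n \<Longrightarrow> A i \<in> sets borel \<and> bounded (A i)) \<Longrightarrow>
        disjoint_family_on A {..<n} \<Longrightarrow>
        indep_vars (\<lambda>_. count_space UNIV) (\<lambda>i \<omega>. card (P \<omega> \<inter> A i)) {..<n}"

text \<open>
  The Poisson process is enumerated without repetition by increasing distance from the origin.
  Ties in the distance have probability 0, so the enumeration is almost surely a function of the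
  random set, and independence of the radii from the enumerating sequence is the same as
  independence from the process. It is stated for the generated sigma-algebras because
  \<^term>\<open>prob_space.indep_var\<close> takes two random variables of the same type.
\<close>

locale spherical_boolean_model =
  homogeneous_poisson_process M intensity "\<lambda>\<omega>. range (\<lambda>k. Y k \<omega>)"
  for M :: "'w measure" and intensity :: real
    and Y :: "nat \<Rightarrow> 'w \<Rightarrow> 'a::euclidean_space" +
  fixes R :: "nat \<Rightarrow> 'w \<Rightarrow> real"
    and \<mu> :: "real measure"
  assumes points_measurable: "\<And>k. Y k \<in> borel_measurable M"
    and points_distinct: "AE \<omega> in M. inj (\<lambda>k. Y k \<omega>)"
    and points_ordered: "AE \<omega> in M. mono (\<lambda>k. norm (Y k \<omega>))"
    and radii_measurable: "\<And>k. R k \<in> borel_measurable M"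
    and radii_distr: "\<And>k. distr M borel (R k) = \<mu>"
    and radii_indep: "indep_vars (\<lambda>_. borel) R UNIV"
    and points_radii_indep:
      "indep_set
        (sets (vimage_algebra (space M) (\<lambda>\<omega> k. Y k \<omega>) (\<Pi>\<^sub>M k\<in>UNIV. borel)))
        (sets (vimage_algebra (space M) (\<lambda>\<omega> k. R k \<omega>) (\<Pi>\<^sub>M k\<in>UNIV. borel)))"

definition occupied_region ::
    "(nat \<Rightarrow> 'w \<Rightarrow> 'a::euclidean_space) \<Rightarrow> (nat \<Rightarrow> 'w \<Rightarrow> real) \<Rightarrow> 'w \<Rightarrow> 'a set" where
  "occupied_region Y R \<omega> = (\<Union>k. cball (Y k \<omega>) (R k \<omega>))"

definition vacant_region ::
    "(nat \<Rightarrow> 'w \<Rightarrow> 'a::euclidean_space) \<Rightarrow> (nat \<Rightarrow> 'w \<Rightarrow> real) \<Rightarrow> 'w \<Rightarrow> 'a set" where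
  "vacant_region Y R \<omega> = UNIV - occupied_region Y R \<omega>"

definition percolates :: "'a::euclidean_space set \<Rightarrow> bool" where
  "percolates S \<longleftrightarrow> (\<exists>C \<in> components S. \<not> bounded C)"

text \<open>
  The arguments are families, indexed by the intensity, of probability spaces carrying a Boolean
  model of that intensity. That vacant percolation has probability 0 is expressed by
  almost-everywhere quantification: the event is in general measurable only in the completion of
  \<^term>\<open>M l\<close>, and \<^term>\<open>measure (M l)\<close> is 0 on all non-measurable sets. The infimum is taken in
  the extended reals, so that it is \<^term>\<open>\<infinity> :: ereal\<close> for the empty set.
\<close>

definition vacancy_critical_value ::
    "(real \<Rightarrow> 'w measure) \<Rightarrow> (real \<Rightarrow> nat \<Rightarrow> 'w \<Rightarrow> 'a::euclidean_space) \<Rightarrow>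
      (real \<Rightarrow> nat \<Rightarrow> 'w \<Rightarrow> real) \<Rightarrow> ereal" where
  "vacancy_critical_value M Y R =
    Inf {ereal l | l. 0 < l \<and> (AE \<omega> in M l. \<not> percolates (vacant_region (Y l) (R l) \<omega>))}"

end

theory Submission
  imports Defs
begin

text \<open>
  There is a threshold, depending only on \<open>\<mu>\<close> and the dimension, below which every model of intensity
  \<open>l\<close> has vacant percolation with positive probability; the critical value is at least this threshold.

  Topology reduces percolation to the absence of large chains of balls. If the vacant component \<open>W\<close>
  of the origin is bounded, then the frontier of the unbounded component of its complement is
  connected (\<open>\<real>\<^sup>d\<close> is unicoherent), it is covered by the balls, and since \<open>d \<ge> 2\<close> it meets both
  the positive and the negative half of a coordinate axis. Hence a chain of overlapping balls leads from
  a point \<open>x\<close> of the positive half-axis to distance at least \<open>\<bar>x\<bar>\<close> from \<open>x\<close>.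

  Such a chain needs a ball whose radius is comparable with its distance from the origin, or else it
  crosses an annulus of some scale \<open>r\<close> near \<open>x\<close> by balls of radius much smaller than \<open>r\<close>. The
  first possibility has probability of order
  \<open>l * (\<Sum>k. 20 ^ (k * d) * measure \<mu> {20 ^ k / 8000<..})\<close>, and this series is dominated by the
  \<open>d\<close>-th moment. For the second, let \<open>f k\<close> be the largest probability of a crossing at scale
  \<open>20 ^ k\<close>. A crossing at scale \<open>20 * r\<close> that uses only balls small with respect to \<open>r\<close> contains two
  crossings at scale \<open>r\<close> in regions far from each other, which are independent. Hence
  \<open>f (Suc k) \<le> C * (f k)\<^sup>2 + l * b k\<close>, where \<open>b k\<close> is a multiple of the \<open>k\<close>-th term of the series
  above. The point of bounding the radii in a crossing is that the error \<open>l * b k\<close> only accounts for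
  balls centred within distance of order \<open>20 ^ k\<close>, and is therefore summable over the scales; large balls
  coming from far away are excluded by the first event, which concerns only the origin. For small \<open>l\<close>
  the quadratic term is at most \<open>f k / 2\<close>, so \<open>\<Sum>k. f k\<close> is of order \<open>l\<close>, and a union bound over
  all scales leaves positive probability for percolation.

  The probabilistic part is carried out on a lattice: space is divided into unit cells, and a cell is
  described by the supremum of the radii of the balls centred in it. Rounding centres to
  cells costs an additive constant in each link of a chain. By the void probabilities of the marked process
  (lemma \<open>marked_void_probability\<close>) these suprema form an independent field, and the multiscale
  argument works with any independent field that has the same bound on its one-site tails. The main steps are
  \<open>vacant_percolates_if_no_crossing\<close> (deterministic), \<open>indep_vars_cell_radius\<close>,
  \<open>crossing_splits\<close>, \<open>prob_crossing_le_halving_sum\<close> and \<open>summable_scaled_tails\<close>.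
\<close>

section \<open>Connected frontiers and chains of closed sets\<close>

text \<open>
  \<open>K\<close> is the frontier of the unbounded component \<open>C\<close> of \<open>- W\<close>. It is connected because the complement
  of a component of the complement of a connected set is connected and Euclidean space is unicoherent.
  In dimension at least 2 the complement of a ball is connected, so a single component \<open>C\<close> contains
  the far parts of both rays; both rays start in \<open>W\<close> and so have to cross the frontier of \<open>C\<close>.
\<close>

lemma connected_frontier_meets_both_rays:
  fixes W :: "'a::euclidean_space set"
  assumes dim: "2 \<le> DIM('a)" and W: "open W" "connected W" "bounded W" "0 \<in> W" and e: "norm e = 1"
  obtains K a b where "connected K" "bounded K" "K \<subseteq> frontier W"
    "0 < a" "a *\<^sub>R e \<in> K" "0 < b" "(- b) *\<^sub>R e \<in> K"
proof -
  obtain B where B: "0 < B" "W \<subseteq> ball 0 B"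
    using W(3) bounded_subset_ballD by blast
  define C where "C = connected_component_set (- W) (B *\<^sub>R e)"
  have out: "- ball 0 B \<subseteq> C"
    unfolding C_def
  proof (rule connected_component_maximal)
    show "B *\<^sub>R e \<in> - ball 0 B" using e B by simp
    show "connected (- ball (0::'a) B)"
      using dim by (intro connected_complement_bounded_convex) auto
    show "- ball 0 B \<subseteq> - W" using B by auto
  qed
  have Be: "B *\<^sub>R e \<in> - W" using B e by auto
  have comp: "C \<in> components (- W)"
    unfolding C_def using Be by (simp add: componentsI)
  have con: "connected (frontier C)"
    using connected_frontier_component_complement[OF W(2) comp] .
  have sub: "frontier C \<subseteq> frontier W"
    using frontier_of_components_subset[OF comp] by (simp add: frontier_complement)
  have "W \<inter> C = {}" using comp in_components_subset by blast
  then have 0: "0 \<notin> C" "0 \<notin> frontier W"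
    using W by (auto simp: frontier_def interior_open)
  have meets: "\<exists>a>0. a *\<^sub>R u \<in> frontier C" if u: "norm u = 1" for u :: 'a
  proof -
    have "closed_segment 0 (B *\<^sub>R u) \<inter> frontier C \<noteq> {}"
    proof (rule connected_Int_frontier)
      show "closed_segment 0 (B *\<^sub>R u) \<inter> C \<noteq> {}"
        using out u B by (auto intro!: exI[of _ "B *\<^sub>R u"] simp: subset_iff)
      show "closed_segment 0 (B *\<^sub>R u) - C \<noteq> {}" using 0 by auto
    qed simp
    then obtain t where t: "0 \<le> t" "t *\<^sub>R B *\<^sub>R u \<in> frontier C"
      by (auto simp: closed_segment_def)
    with 0 sub have "t \<noteq> 0" by auto
    with t B show ?thesis by (intro exI[of _ "t * B"]) auto
  qed
  obtain a where a: "a > 0" "a *\<^sub>R e \<in> frontier C" using meets[OF e] by auto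
  obtain b where b: "b > 0" "b *\<^sub>R (- e) \<in> frontier C" using meets[of "-e"] e by auto
  have "bounded (frontier W)"
    using W(3) bounded_closure by (auto simp: frontier_def intro: bounded_subset)
  then have bdd: "bounded (frontier C)" using sub by (rule bounded_subset)
  show thesis
    using b(2) by (intro that[OF con bdd sub a b(1)]) simp
qed

text \<open>
  The sets reachable from \<open>B i\<close> and the remaining ones have disjoint closed unions, which would
  disconnect \<open>K\<close> if both met it.
\<close>

lemma connected_subset_Union_closed_chain:
  fixes K :: "'a::topological_space set"
  assumes J: "finite J" "\<And>j. j \<in> J \<Longrightarrow> closed (B j)" and K: "connected K" "K \<subseteq> (\<Union>j\<in>J. B j)"
    and x: "x \<in> K" "i \<in> J" "x \<in> B i" and y: "y \<in> K"
  obtains j where "j \<in> J" "y \<in> B j" "(i, j) \<in> {(k, l). k \<in> J \<and> l \<in> J \<and> B k \<inter> B l \<noteq> {}}\<^sup>*"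
proof -
  let ?E = "{(k, l). k \<in> J \<and> l \<in> J \<and> B k \<inter> B l \<noteq> {}}"
  define I where "I = {j \<in> J. (i, j) \<in> ?E\<^sup>*}"
  have disj: "B k \<inter> B l = {}" if "k \<in> I" "l \<in> J - I" for k l
  proof (rule ccontr)
    assume "B k \<inter> B l \<noteq> {}"
    with that have "(k, l) \<in> ?E" by (auto simp: I_def)
    with that show False by (auto simp: I_def intro: rtrancl_into_rtrancl)
  qed
  have fin: "finite I" "finite (J - I)" using J by (auto simp: I_def)
  have cl: "closed (\<Union>j\<in>L. B j)" if "L \<subseteq> J" for L
    using J that finite_subset by (intro closed_UN) auto
  have "(\<Union>j\<in>I. B j) \<inter> K = {} \<or> (\<Union>j\<in>J - I. B j) \<inter> K = {}"
  proof (rule connected_closedD[OF K(1)])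
    show "(\<Union>j\<in>I. B j) \<inter> (\<Union>j\<in>J - I. B j) \<inter> K = {}" using disj by blast
    show "K \<subseteq> (\<Union>j\<in>I. B j) \<union> (\<Union>j\<in>J - I. B j)" using K(2) by blast
  qed (use cl in \<open>auto simp: I_def\<close>)
  moreover have "x \<in> (\<Union>j\<in>I. B j) \<inter> K" using x by (auto simp: I_def)
  ultimately have "y \<in> (\<Union>j\<in>I. B j)" using K y by blast
  then show thesis using that by (auto simp: I_def)
qed

section \<open>Chains and crossings on the lattice\<close>

definition ldist :: "('n::finite \<Rightarrow> int) \<Rightarrow> ('n \<Rightarrow> int) \<Rightarrow> int" where
  "ldist p q = Max (range (\<lambda>i. \<bar>p i - q i\<bar>))"

lemma ldist_le_iff: "ldist p q \<le> r \<longleftrightarrow> (\<forall>i. \<bar>p i - q i\<bar> \<le> r)"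
  unfolding ldist_def by (subst Max_le_iff) auto

lemma coord_le_ldist: "\<bar>p i - q i\<bar> \<le> ldist p q"
  using ldist_le_iff[of p q "ldist p q"] by auto

lemma ldist_commute: "ldist p q = ldist q p"
  unfolding ldist_def by (simp add: abs_minus_commute)

lemma ldist_triangle: "ldist p q \<le> ldist p s + ldist s q"
  unfolding ldist_le_iff
proof
  fix i
  show "\<bar>p i - q i\<bar> \<le> ldist p s + ldist s q"
    using coord_le_ldist[of p i s] coord_le_ldist[of s i q] by linarith
qed

lemma ldist_cube: "{q. ldist q c \<le> r} = (\<Pi>\<^sub>E i\<in>UNIV. {c i - r..c i + r})"
  by (auto simp: ldist_le_iff PiE_def Pi_def abs_le_iff) (smt (verit))+

lemma finite_ldist_cube: "finite {q::'n::finite \<Rightarrow> int. ldist q c \<le> r}"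
  unfolding ldist_cube by (intro finite_PiE) auto

lemma card_ldist_cube: "card {q::'n::finite \<Rightarrow> int. ldist q c \<le> r} = nat (2 * r + 1) ^ CARD('n)"
  unfolding ldist_cube by (subst card_PiE) (auto simp: algebra_simps)

text \<open>
  The points of \<open>c + r \<int>\<^sup>n\<close> in a cube around \<open>c\<close>: a family of possible centres at scale \<open>r\<close> whose
  cardinality is bounded independently of \<open>r\<close>.
\<close>

definition subgrid :: "('n::finite \<Rightarrow> int) \<Rightarrow> int \<Rightarrow> int \<Rightarrow> ('n \<Rightarrow> int) set" where
  "subgrid c h r = (\<lambda>z i. c i + r * z i) ` {z. ldist z (\<lambda>_. 0) \<le> h}"

lemma finite_subgrid: "finite (subgrid c h r)"
  unfolding subgrid_def by (intro finite_imageI finite_ldist_cube)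

lemma card_subgrid: "card (subgrid (c :: 'n::finite \<Rightarrow> int) h r) \<le> nat (2 * h + 1) ^ CARD('n)"
  unfolding subgrid_def card_ldist_cube[of "\<lambda>_. 0", symmetric]
  by (intro card_image_le finite_ldist_cube)

lemma near_subgrid:
  assumes r: "0 < r" and p: "ldist p c \<le> h * r"
  obtains s where "s \<in> subgrid c h r" "ldist p s \<le> r"
proof -
  define z where "z = (\<lambda>i. (p i - c i) div r)"
  have z: "r * z i \<le> p i - c i" "p i - c i < r * z i + r" for i
    using r pos_mod_bound[of r "p i - c i"] pos_mod_sign[of r "p i - c i"] 
      mult_div_mod_eq[of r "p i - c i"] unfolding z_def by linarith+
  have "\<bar>z i\<bar> \<le> h" for i
  proof -
    have 1: "p i - c i \<le> h * r" "- (h * r) \<le> p i - c i"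
      using coord_le_ldist[of p i c] p by linarith+
    have "r * z i \<le> r * h" using z(1)[of i] 1 by (simp add: mult.commute)
    then have a: "z i \<le> h" using r by simp
    have "r * (- h) < r * (z i + 1)" using z(2)[of i] 1 by (simp add: algebra_simps)
    then have "- h < z i + 1" using r by (simp only: mult_less_cancel_left_pos)
    with a show ?thesis by linarith
  qed
  then have "(\<lambda>i. c i + r * z i) \<in> subgrid c h r"
    unfolding subgrid_def by (intro imageI) (auto simp: ldist_le_iff)
  moreover have "ldist p (\<lambda>i. c i + r * z i) \<le> r"
    unfolding ldist_le_iff using z by (smt (verit))
  ultimately show thesis using that by blast
qed

text \<open>
  A value \<open>f q > - 1\<close> means that the cell \<open>q\<close> contains the centre of a ball, since radii are
  nonnegative and an empty cell carries the value \<open>- \<infinity>\<close>. The summand 1 in the distance condition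
  compensates for rounding centres to cells.
\<close>

definition link :: "(('n::finite \<Rightarrow> int) \<Rightarrow> ereal) \<Rightarrow> ('n \<Rightarrow> int) set \<Rightarrow> (('n \<Rightarrow> int) \<times> ('n \<Rightarrow> int)) set" where
  "link f S = {(p, q). p \<in> S \<and> q \<in> S \<and> - 1 < f p \<and> - 1 < f q \<and>
     ereal (of_int (ldist p q)) \<le> f p + f q + 1}"

text \<open>
  A chain of balls from the cube of radius \<open>r\<close> around \<open>c\<close> to the outside of the cube of radius \<open>2 * r\<close>.
  Restricting to sites within distance \<open>3 * r\<close> makes this event local. The bound \<open>r / 16\<close> on the radii
  keeps the steps so short that a longer chain, cut where it first leaves the cube of radius
  \<open>2 * r\<close>, stays within distance \<open>3 * r\<close>.
\<close>

definition crossing :: "(('n::finite \<Rightarrow> int) \<Rightarrow> ereal) \<Rightarrow> ('n \<Rightarrow> int) \<Rightarrow> int \<Rightarrow> bool" where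
  "crossing f c r \<longleftrightarrow> (\<exists>p q. ldist p c \<le> r \<and> 2 * r \<le> ldist q c \<and>
     (p, q) \<in> (link f {s. ldist s c \<le> 3 * r \<and> f s \<le> ereal (of_int r / 16)})\<^sup>*)"

lemma first_exit:
  assumes "(p, q) \<in> E\<^sup>*" "P p" "\<not> P q"
  obtains u v where "(p, u) \<in> (E \<inter> {(x, y). P x \<and> P y})\<^sup>*" "P u" "(u, v) \<in> E" "\<not> P v" "(v, q) \<in> E\<^sup>*"
proof -
  have "\<exists>u v. (p, u) \<in> (E \<inter> {(x, y). P x \<and> P y})\<^sup>* \<and> P u \<and> (u, v) \<in> E \<and> \<not> P v \<and> (v, q) \<in> E\<^sup>*"
    using assms
  proof (induction rule: converse_rtrancl_induct)
    case base
    then show ?case by simp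
  next
    case (step y z)
    show ?case
    proof (cases "P z")
      case True
      then obtain u v where uv: "(z, u) \<in> (E \<inter> {(x, y). P x \<and> P y})\<^sup>*" "P u" "(u, v) \<in> E" "\<not> P v" "(v, q) \<in> E\<^sup>*"
        using step by blast
      moreover have "(y, z) \<in> E \<inter> {(x, y). P x \<and> P y}" using True step by auto
      ultimately show ?thesis by (meson converse_rtrancl_into_rtrancl)
    next
      case False
      then show ?thesis using step by blast
    qed
  qed
  then show thesis using that by blast
qed

lemma link_short:
  assumes "(p, q) \<in> link f S" "f p \<le> ereal a" "f q \<le> ereal b"
  shows "of_int (ldist p q) \<le> a + b + 1"
proof -
  have "ereal (of_int (ldist p q)) \<le> f p + f q + 1" using assms(1) by (simp add: link_def)
  also have "\<dots> \<le> ereal a + ereal b + 1" using assms by (intro add_mono) auto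
  finally show ?thesis by (simp add: one_ereal_def)
qed

text \<open>
  The chain may run through all of \<open>S\<close>; it is cut at its first exit from the cube of radius \<open>2 * r\<close>.
\<close>

lemma crossingI:
  assumes "0 < r" and pq: "(p, q) \<in> (link f S)\<^sup>*" "ldist p c \<le> r" "2 * r \<le> ldist q c"
    and small: "\<And>s. s \<in> S \<Longrightarrow> - 1 < f s \<Longrightarrow> ldist s c \<le> 3 * r \<Longrightarrow> f s \<le> ereal (of_int r / 16)"
    and step: "\<And>u v. (u, v) \<in> link f S \<Longrightarrow> ldist u c < 2 * r \<Longrightarrow> ldist v c \<le> 3 * r"
  shows "crossing f c r"
proof -
  let ?P = "\<lambda>s. ldist s c < 2 * r"
  let ?T = "{s. ldist s c \<le> 3 * r \<and> f s \<le> ereal (of_int r / 16)}"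
  obtain u v where uv: "(p, u) \<in> (link f S \<inter> {(x, y). ?P x \<and> ?P y})\<^sup>*" "?P u" "(u, v) \<in> link f S" "\<not> ?P v"
  proof (rule first_exit[OF pq(1), of ?P])
    show "?P p" "\<not> ?P q" using pq \<open>0 < r\<close> by auto
  qed blast
  have "link f S \<inter> {(x, y). ?P x \<and> ?P y} \<subseteq> link f ?T"
    using \<open>0 < r\<close> by (auto simp: link_def intro!: small)
  then have "(p, u) \<in> (link f ?T)\<^sup>*" using uv(1) rtrancl_mono by blast
  moreover have "(u, v) \<in> link f ?T"
    using uv(2,3) small step[OF uv(3,2)] \<open>0 < r\<close> by (auto simp: link_def)
  ultimately have "(p, v) \<in> (link f ?T)\<^sup>*" by (rule rtrancl_into_rtrancl)
  then show ?thesis unfolding crossing_def using uv(4) pq(2) by (intro exI[of _ p] exI[of _ v]) auto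
qed

text \<open>
  A chain with steps of length at most \<open>r / 4\<close> from distance at most \<open>20 * r\<close> to distance at least
  \<open>40 * r\<close> has to cross around its starting point as well as around the point where it first exceeds
  distance \<open>35 * r\<close>. The centres of these crossings are at distance at least \<open>13 * r\<close>, so the cubes
  of radius \<open>3 * r\<close> on which the two crossings depend are disjoint.
\<close>

lemma crossing_splits:
  fixes f :: "('n::finite \<Rightarrow> int) \<Rightarrow> ereal"
  assumes r: "8 \<le> r" and cr: "crossing f c (20 * r)"
    and small: "\<And>s. ldist s c \<le> 60 * r \<Longrightarrow> f s \<le> ereal (of_int r / 16)"
  obtains c1 c2 where "c1 \<in> subgrid c 37 r" "c2 \<in> subgrid c 37 r" "6 * r < ldist c1 c2"
    "crossing f c1 r" "crossing f c2 r"
proof -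
  define S where "S = {s. ldist s c \<le> 3 * (20 * r) \<and> f s \<le> ereal (of_int (20 * r) / 16)}"
  obtain p q where pq: "ldist p c \<le> 20 * r" "2 * (20 * r) \<le> ldist q c" "(p, q) \<in> (link f S)\<^sup>*"
    using cr unfolding crossing_def S_def by blast
  have S: "f s \<le> ereal (of_int r / 16)" if "s \<in> S" for s
    using that small by (simp add: S_def)
  have jump: "4 * ldist u v \<le> r" if "(u, v) \<in> link f S" for u v
  proof -
    have "u \<in> S" "v \<in> S" using that by (auto simp: link_def)
    then have "real_of_int (ldist u v) \<le> of_int r / 16 + of_int r / 16 + 1"
      by (intro link_short[OF that] S)
    then show ?thesis using r by linarith
  qed
  have cross: "crossing f c' r"
    if "ldist p' c' \<le> r" "2 * r \<le> ldist q' c'" "(p', q') \<in> (link f S)\<^sup>*" for c' p' q'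
  proof (rule crossingI[OF _ that(3,1,2)])
    show "ldist v c' \<le> 3 * r" if "(u, v) \<in> link f S" "ldist u c' < 2 * r" for u v
      using jump[OF that(1)] that(2) ldist_triangle[of v c' u] ldist_commute[of u v] r by linarith
  qed (use r S in auto)
  obtain c1 where c1: "c1 \<in> subgrid c 37 r" "ldist p c1 \<le> r"
    using near_subgrid[of r p c 37] pq r by auto
  have "ldist q c \<le> ldist q c1 + ldist c1 p + ldist p c"
    using ldist_triangle[of q c c1] ldist_triangle[of c1 c p] by linarith
  then have x1: "crossing f c1 r"
    using pq c1 r ldist_commute[of c1 p] by (intro cross[of p _ q]) auto
  \<comment> \<open>The exit point \<open>v\<close> has distance at most \<open>35.25 * r\<close>, hence a grid point \<open>c2\<close> of the cube of radius
    \<open>37 * r\<close> near it, and the end \<open>q\<close> at distance at least \<open>40 * r\<close> is still farther than \<open>2 * r\<close> from \<open>c2\<close>.\<close>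
  obtain u v where uv: "ldist u c \<le> 35 * r" "(u, v) \<in> link f S" "\<not> ldist v c \<le> 35 * r" "(v, q) \<in> (link f S)\<^sup>*"
  proof (rule first_exit[OF pq(3), of "\<lambda>s. ldist s c \<le> 35 * r"])
    show "ldist p c \<le> 35 * r" "\<not> ldist q c \<le> 35 * r" using pq r by auto
  qed blast
  have v: "4 * ldist v c \<le> 141 * r"
    using jump[OF uv(2)] uv(1) ldist_triangle[of v c u] ldist_commute[of u v] by linarith
  then obtain c2 where c2: "c2 \<in> subgrid c 37 r" "ldist v c2 \<le> r"
    using near_subgrid[of r v c 37] r by auto
  have "ldist q c \<le> ldist q c2 + ldist c2 v + ldist v c"
    using ldist_triangle[of q c c2] ldist_triangle[of c2 c v] by linarith
  then have x2: "crossing f c2 r"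
    using pq c2 v r ldist_commute[of c2 v] by (intro cross[of v _ q] uv) auto
  have "ldist v c \<le> ldist v c2 + ldist c2 c1 + ldist c1 p + ldist p c"
    using ldist_triangle[of v c c2] ldist_triangle[of c2 c c1] ldist_triangle[of c1 c p] by linarith
  then have "6 * r < ldist c1 c2"
    using uv(3) c1 c2 pq r ldist_commute[of c1 c2] ldist_commute[of c1 p] by linarith
  with c1 c2 x1 x2 that show thesis by blast
qed

section \<open>From absence of crossings to vacant percolation\<close>

definition cell_of :: "real ^ 'n \<Rightarrow> 'n \<Rightarrow> int" where
  "cell_of y = (\<lambda>i. \<lfloor>y $ i\<rfloor>)"

lemma ldist_cell_of: "of_int (ldist (cell_of y) (cell_of z)) \<le> dist y z + 1"
proof -
  have "ldist (cell_of y) (cell_of z) \<le> \<lfloor>dist y z + 1\<rfloor>"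
    unfolding ldist_le_iff cell_of_def
  proof
    fix i
    have "\<bar>y $ i - z $ i\<bar> \<le> dist y z"
      using component_le_norm_cart[of "y - z" i] by (simp add: dist_norm)
    then show "\<bar>\<lfloor>y $ i\<rfloor> - \<lfloor>z $ i\<rfloor>\<bar> \<le> \<lfloor>dist y z + 1\<rfloor>" by linarith
  qed
  then show ?thesis by linarith
qed

lemma cell_of_0: "cell_of 0 = (\<lambda>_. 0)"
  by (simp add: cell_of_def)

lemma bracket_power20:
  fixes n :: int
  assumes "20 ^ 3 < n"
  obtains k where "3 \<le> k" "20 ^ k < n" "n \<le> 20 ^ Suc k"
proof -
  have ex: "\<exists>k. n \<le> 20 ^ k"
  proof -
    have "nat n < 20 ^ nat n" by (rule power_gt_expt) simp
    then have "int (nat n) < 20 ^ nat n" by (simp flip: of_nat_less_iff[where 'a=int])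
    then show ?thesis by (intro exI[of _ "nat n"]) linarith
  qed
  define K where "K = (LEAST k. n \<le> (20::int) ^ k)"
  have K: "n \<le> 20 ^ K" unfolding K_def using ex by (rule LeastI_ex)
  have "3 < K"
  proof (rule ccontr)
    assume "\<not> 3 < K"
    then have "(20::int) ^ K \<le> 20 ^ 3" by (intro power_increasing) auto
    with K assms show False by linarith
  qed
  then obtain k where k: "K = Suc k" "3 \<le> k" by (cases K) auto
  have "\<not> n \<le> 20 ^ k" using not_less_Least[of k "\<lambda>k. n \<le> (20::int) ^ k"] k unfolding K_def by simp
  with K k that show thesis by auto
qed

lemma closed_locally_finite_Union_cball:
  fixes y :: "nat \<Rightarrow> 'a::real_normed_vector"
  assumes "\<And>B. bounded B \<Longrightarrow> finite {k. cball (y k) (\<rho> k) \<inter> B \<noteq> {}}"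
  shows "closed (\<Union>k. cball (y k) (\<rho> k))"
proof -
  have "open (- (\<Union>k. cball (y k) (\<rho> k)))"
    unfolding open_subopen[of "- (\<Union>k. cball (y k) (\<rho> k))"]
  proof
    fix x assume x: "x \<in> - (\<Union>k. cball (y k) (\<rho> k))"
    let ?J = "{k. cball (y k) (\<rho> k) \<inter> ball x 1 \<noteq> {}}"
    have "closed (\<Union>k\<in>?J. cball (y k) (\<rho> k))"
      using assms[of "ball x 1"] by (intro closed_UN) auto
    then have "open (ball x 1 - (\<Union>k\<in>?J. cball (y k) (\<rho> k)))" by (intro open_Diff) auto
    moreover have "ball x 1 - (\<Union>k\<in>?J. cball (y k) (\<rho> k)) \<subseteq> - (\<Union>k. cball (y k) (\<rho> k))" by blast
    moreover have "x \<in> ball x 1 - (\<Union>k\<in>?J. cball (y k) (\<rho> k))" using x by auto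
    ultimately show "\<exists>T. open T \<and> x \<in> T \<and> T \<subseteq> - (\<Union>k. cball (y k) (\<rho> k))" by blast
  qed
  then show ?thesis by (simp add: closed_def)
qed

text \<open>
  The values \<open>f\<close> bound the radii of the balls by the cell of their centre. The hypotheses \<open>empty\<close> and
  \<open>small\<close> say that a ball is smaller by a factor 8000 than the distance of its cell from the origin;
  hence only finitely many balls meet a bounded set, and the union of the balls is closed. If the vacant component of the origin were bounded, the chain along its frontier from the
  positive to the negative half-axis would start at a cell \<open>p\<close> with \<open>20 * r < \<bar>p\<bar> \<le> 400 * r\<close> for a
  scale \<open>r\<close>, where balls have radius at most \<open>r / 16\<close>, and would contain a crossing at scale \<open>r\<close>.
\<close>

lemma vacant_percolates_if_no_crossing:
  fixes y :: "nat \<Rightarrow> real ^ 'n" and f :: "('n \<Rightarrow> int) \<Rightarrow> ereal"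
  assumes dim: "2 \<le> CARD('n)"
    and fin: "\<And>B. bounded B \<Longrightarrow> finite {k. y k \<in> B}"
    and nonneg: "\<And>k. 0 \<le> \<rho> k"
    and f: "\<And>k. ereal (\<rho> k) \<le> f (cell_of (y k))"
    and empty: "\<And>q. ldist q (\<lambda>_. 0) \<le> 20 ^ 3 \<Longrightarrow> f q \<le> - 1"
    and small: "\<And>k q. 3 \<le> k \<Longrightarrow> ldist q (\<lambda>_. 0) \<le> 20 ^ Suc k \<Longrightarrow> f q \<le> ereal (20 ^ k / 8000)"
    and no_crossing: "\<And>k c. 1 \<le> k \<Longrightarrow> c \<in> subgrid (\<lambda>_. 0) 400 (20 ^ k) \<Longrightarrow> \<not> crossing f c (20 ^ k)"
  shows "percolates (UNIV - (\<Union>k. cball (y k) (\<rho> k)))"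
proof -
  let ?Z = "\<Union>k. cball (y k) (\<rho> k)"
  let ?n = "\<lambda>q::'n \<Rightarrow> int. ldist q (\<lambda>_. 0)"
  have f_bound: "?n q > 8000" "f q \<le> ereal (of_int (?n q) / 8000)" if "- 1 < f q" for q
  proof -
    show gt: "?n q > 8000" using empty[of q] that by force
    then obtain k where k: "3 \<le> k" "20 ^ k < ?n q" "?n q \<le> 20 ^ Suc k"
      using bracket_power20[of "?n q"] by auto
    have "f q \<le> ereal (20 ^ k / 8000)" using small k by blast
    also have "\<dots> \<le> ereal (of_int (?n q) / 8000)"
    proof -
      have "real_of_int (20 ^ k) \<le> real_of_int (?n q)" using k(2) by (simp only: of_int_le_iff)
      then show ?thesis by simp
    qed
    finally show "f q \<le> ereal (of_int (?n q) / 8000)" .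
  qed
  have act: "- 1 < f (cell_of (y k))" for k
  proof -
    have "- 1 < ereal (\<rho> k)" using nonneg[of k] by (simp add: one_ereal_def)
    then show ?thesis using f[of k] by (rule less_le_trans)
  qed
  have \<rho>: "8000 < ?n (cell_of (y k))" "8000 * \<rho> k \<le> of_int (?n (cell_of (y k)))" for k
    using f_bound[OF act[of k]] order.trans[OF f[of k] f_bound(2)[OF act[of k]]] by auto
  have near: "norm (y k) \<le> 2 * norm z + 1" if "z \<in> cball (y k) (\<rho> k)" for z k
  proof -
    have "norm (y k) \<le> norm z + \<rho> k"
      using that norm_triangle_ineq[of z "y k - z"] by (simp add: dist_norm)
    moreover have "of_int (?n (cell_of (y k))) \<le> norm (y k) + 1"
      using ldist_cell_of[of "y k" 0] by (simp add: cell_of_0)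
    ultimately show ?thesis using \<rho>(2)[of k] norm_ge_zero[of "y k"] norm_ge_zero[of z] by linarith
  qed
  have locfin: "finite {k. cball (y k) (\<rho> k) \<inter> B \<noteq> {}}" if B: "bounded B" for B
  proof -
    obtain b where "\<And>z. z \<in> B \<Longrightarrow> norm z \<le> b" using B by (auto simp: bounded_iff)
    then have "{k. cball (y k) (\<rho> k) \<inter> B \<noteq> {}} \<subseteq> {k. y k \<in> cball 0 (2 * b + 1)}"
      using near by fastforce
    then show ?thesis using fin[OF bounded_cball] finite_subset by blast
  qed
  have closed: "closed ?Z" using locfin by (rule closed_locally_finite_Union_cball)
  have "0 \<notin> ?Z"
  proof
    assume "0 \<in> ?Z"
    then obtain k where "norm (y k) \<le> 1" using near[of 0] by fastforce
    then have "of_int (?n (cell_of (y k))) \<le> (2::real)"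
      using ldist_cell_of[of "y k" 0] by (simp add: cell_of_0)
    with \<rho>(1)[of k] show False by linarith
  qed
  define W where "W = connected_component_set (- ?Z) 0"
  have W: "open W" "connected W" "0 \<in> W"
    unfolding W_def using open_connected_component[OF open_Compl[OF closed], of 0] \<open>0 \<notin> ?Z\<close>
    by (simp_all only: connected_connected_component connected_component_refl_eq Compl_iff mem_Collect_eq not_False_eq_True)
  have comp: "W \<in> components (- ?Z)"
    unfolding W_def using \<open>0 \<notin> ?Z\<close> by (auto intro: componentsI)
  have frontier: "frontier W \<subseteq> ?Z"
    using frontier_of_components_subset[OF comp] frontier_subset_closed[OF closed]
    unfolding frontier_complement by (rule order_trans)
  have "\<not> bounded W"
  proof
    assume "bounded W"
    fix i :: 'n
    define e where "e = (axis i 1 :: real ^ 'n)"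
    obtain K a b where K: "connected K" "bounded K" "K \<subseteq> frontier W" and ab: "0 < a" "a *\<^sub>R e \<in> K" "0 < b" "(- b) *\<^sub>R e \<in> K"
      by (rule connected_frontier_meets_both_rays[OF _ W(1,2) \<open>bounded W\<close> W(3), of e]) (use dim in \<open>auto simp: e_def\<close>)
    define J where "J = {k. cball (y k) (\<rho> k) \<inter> K \<noteq> {}}"
    have J: "finite J" unfolding J_def using locfin K(2) by blast
    have KJ: "K \<subseteq> (\<Union>k\<in>J. cball (y k) (\<rho> k))" using K(3) frontier by (fastforce simp: J_def)
    then obtain k0 where k0: "k0 \<in> J" "a *\<^sub>R e \<in> cball (y k0) (\<rho> k0)" using ab by blast
    obtain k1 where k1: "k1 \<in> J" "(- b) *\<^sub>R e \<in> cball (y k1) (\<rho> k1)"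
      and chain: "(k0, k1) \<in> {(k, l). k \<in> J \<and> l \<in> J \<and> cball (y k) (\<rho> k) \<inter> cball (y l) (\<rho> l) \<noteq> {}}\<^sup>*"
      by (rule connected_subset_Union_closed_chain[OF J _ K(1) KJ ab(2) k0 ab(4)]) auto
    define p where "p = cell_of (y k0)"
    define q where "q = cell_of (y k1)"
    have pq: "(p, q) \<in> (link f UNIV)\<^sup>*"
      unfolding p_def q_def
      using chain
    proof (induction rule: rtrancl_induct)
      case (step k l)
      from step.hyps(2) obtain z where "dist (y k) z \<le> \<rho> k" "dist (y l) z \<le> \<rho> l" by auto
      then have "dist (y k) (y l) \<le> \<rho> k + \<rho> l"
        using dist_triangle2[of "y k" "y l" z] by linarith
      then have "of_int (ldist (cell_of (y k)) (cell_of (y l))) \<le> \<rho> k + \<rho> l + 1"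
        using ldist_cell_of[of "y k" "y l"] by linarith
      then have "ereal (of_int (ldist (cell_of (y k)) (cell_of (y l)))) \<le> ereal (\<rho> k) + ereal (\<rho> l) + 1"
        by (simp add: one_ereal_def)
      also have "\<dots> \<le> f (cell_of (y k)) + f (cell_of (y l)) + 1"
        using f by (intro add_mono) auto
      finally have "(cell_of (y k), cell_of (y l)) \<in> link f UNIV" using act by (simp add: link_def)
      with step.IH show ?case by (rule rtrancl_into_rtrancl)
    qed simp
    \<comment> \<open>A ball that meets the axis at coordinate \<open>t\<close> is so small that its centre lies near the axis, on the
      same side of the origin.\<close>
    have ray: "\<bar>of_int (cell_of (y k) i) - t\<bar> \<le> of_int (?n (cell_of (y k))) / 8000 + 1"
        "of_int (?n (cell_of (y k))) \<le> \<bar>t\<bar> + of_int (?n (cell_of (y k))) / 8000 + 1"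
      if "t *\<^sub>R e \<in> cball (y k) (\<rho> k)" for t k
    proof -
      have d: "dist (y k) (t *\<^sub>R e) \<le> \<rho> k" using that by simp
      have "\<bar>y k $ i - t\<bar> \<le> \<rho> k"
        using component_le_norm_cart[of "y k - t *\<^sub>R e" i] d by (simp add: dist_norm e_def)
      then show "\<bar>of_int (cell_of (y k) i) - t\<bar> \<le> of_int (?n (cell_of (y k))) / 8000 + 1"
        using \<rho>(2)[of k] unfolding cell_of_def by linarith
      have "dist (y k) 0 \<le> \<bar>t\<bar> + \<rho> k"
        using dist_triangle[of "y k" 0 "t *\<^sub>R e"] d by (simp add: e_def)
      then show "of_int (?n (cell_of (y k))) \<le> \<bar>t\<bar> + of_int (?n (cell_of (y k))) / 8000 + 1"
        using \<rho>(2)[of k] ldist_cell_of[of "y k" 0] by (simp add: cell_of_0)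
    qed
    have P: "8000 < ?n p" "10 * p i \<ge> 9 * ?n p"
      using ray[OF k0(2)] \<rho>(1)[of k0] ab(1) unfolding p_def by linarith+
    have Q: "q i \<le> 0"
      using ray[OF k1(2)] \<rho>(1)[of k1] ab(3) unfolding q_def by linarith
    obtain k where k: "3 \<le> k" "20 ^ k < ?n p" "?n p \<le> 20 ^ Suc k"
      using bracket_power20[of "?n p"] P by auto
    define r :: int where "r = 20 ^ (k - 1)"
    have "(20::int) ^ k = 20 * 20 ^ (k - 1)" using k(1) by (cases k) auto
    then have r: "20 * r < ?n p" "?n p \<le> 400 * r" using k by (auto simp: r_def)
    have "(20::int) ^ 2 \<le> r" unfolding r_def using k(1) by (intro power_increasing) auto
    then have r400: "400 \<le> r" by simp
    obtain c where c: "c \<in> subgrid (\<lambda>_. 0) 400 r" "ldist p c \<le> r"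
      using near_subgrid[of r p "\<lambda>_. 0" 400] r r400 by auto
    have n_near: "?n s \<le> 401 * r + ldist s c" for s
      using ldist_triangle[of s "\<lambda>_. 0" c] ldist_triangle[of c "\<lambda>_. 0" p] ldist_commute[of c p] c r by linarith
    have "crossing f c r"
    proof (rule crossingI[OF _ pq c(2)])
      have "q i - c i \<le> - 17 * r" using Q P(2) r coord_le_ldist[of p i c] c(2) by linarith
      then show "2 * r \<le> ldist q c" using coord_le_ldist[of q i c] r400 by linarith
      show "f s \<le> ereal (of_int r / 16)" if "- 1 < f s" "ldist s c \<le> 3 * r" for s
      proof -
        have "of_int (?n s) / 8000 \<le> real_of_int r / 16" using n_near[of s] that(2) r400 by linarith
        then show ?thesis using f_bound(2)[OF that(1)] order.trans by fastforce
      qed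
      show "ldist v c \<le> 3 * r" if uv: "(u, v) \<in> link f UNIV" "ldist u c < 2 * r" for u v
      proof -
        have "- 1 < f u" "- 1 < f v" using uv by (auto simp: link_def)
        then have "of_int (ldist u v) \<le> of_int (?n u) / 8000 + of_int (?n v) / 8000 + (1::real)"
          using link_short[OF uv(1)] f_bound(2) by blast
        moreover have "?n v \<le> ?n u + ldist u v"
          using ldist_triangle[of v "\<lambda>_. 0" u] ldist_commute[of u v] by linarith
        ultimately have "ldist u v \<le> r" using n_near[of u] uv(2) r400 by linarith
        then show ?thesis using ldist_triangle[of v c u] ldist_commute[of u v] uv(2) by linarith
      qed
    qed (use r400 in auto)
    moreover have "1 \<le> k - 1" using k(1) by simp
    ultimately show False using no_crossing[of "k - 1" c] c(1) by (simp add: r_def)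
  qed
  then show ?thesis using comp by (auto simp: percolates_def Compl_eq_Diff_UNIV)
qed

section \<open>Void probabilities of the marked process\<close>

text \<open>
  Independence of generated sigma-algebras, unlike the predicate for pairs of random variables, allows
  \<open>X\<close> and \<open>Y\<close> to take values in spaces of different types.
\<close>

lemma (in prob_space) joint_distr_of_indep_vimage:
  assumes X: "X \<in> measurable M N" and Y: "Y \<in> measurable M L"
    and indep: "indep_set (sets (vimage_algebra (space M) X N)) (sets (vimage_algebra (space M) Y L))"
  shows "distr M (N \<Otimes>\<^sub>M L) (\<lambda>\<omega>. (X \<omega>, Y \<omega>)) = distr M N X \<Otimes>\<^sub>M distr M L Y"
proof -
  interpret X: prob_space "distr M N X" using X by (rule prob_space_distr)
  interpret Y: prob_space "distr M L Y" using Y by (rule prob_space_distr)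
  note [measurable] = X Y
  have "distr M N X \<Otimes>\<^sub>M distr M L Y = distr M (N \<Otimes>\<^sub>M L) (\<lambda>\<omega>. (X \<omega>, Y \<omega>))"
  proof (rule pair_measure_eqI)
    fix A B assume "A \<in> sets (distr M N X)" "B \<in> sets (distr M L Y)"
    then have [measurable]: "A \<in> sets N" "B \<in> sets L" by auto
    have "(\<lambda>\<omega>. (X \<omega>, Y \<omega>)) -` (A \<times> B) \<inter> space M = (X -` A \<inter> space M) \<inter> (Y -` B \<inter> space M)" by auto
    moreover have "prob \<dots> = prob (X -` A \<inter> space M) * prob (Y -` B \<inter> space M)"
      by (intro indep_setD[OF indep] in_vimage_algebra) auto
    ultimately show "emeasure (distr M N X) A * emeasure (distr M L Y) B =
        emeasure (distr M (N \<Otimes>\<^sub>M L) (\<lambda>\<omega>. (X \<omega>, Y \<omega>))) (A \<times> B)"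
      by (simp add: emeasure_distr emeasure_eq_measure ennreal_mult)
  qed (simp_all add: X.sigma_finite_measure_axioms Y.sigma_finite_measure_axioms cong: sets_pair_measure_cong)
  then show ?thesis ..
qed

text \<open>
  The probability generating function of a Poisson count.
\<close>

lemma (in homogeneous_poisson_process) nn_integral_power_count:
  assumes B: "B \<in> sets borel" "bounded B" and m: "0 \<le> m"
  shows "(\<integral>\<^sup>+ \<omega>. ennreal (m ^ card (P \<omega> \<inter> B)) \<partial>M) = ennreal (exp (- (intensity * measure lborel B * (1 - m))))"
proof -
  define v where "v = intensity * measure lborel B"
  have v: "0 \<le> v" using intensity_pos by (simp add: v_def)
  note [measurable] = count_measurable[OF B]
  have "(\<integral>\<^sup>+ \<omega>. ennreal (m ^ card (P \<omega> \<inter> B)) \<partial>M)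
      = (\<integral>\<^sup>+ \<omega>. (\<Sum>n. ennreal (m ^ n) * indicator {\<omega> \<in> space M. card (P \<omega> \<inter> B) = n} \<omega>) \<partial>M)"
  proof (intro nn_integral_cong)
    fix \<omega> assume "\<omega> \<in> space M"
    then have "(\<Sum>n. ennreal (m ^ n) * indicator {\<omega> \<in> space M. card (P \<omega> \<inter> B) = n} \<omega>)
        = (\<Sum>n\<in>{card (P \<omega> \<inter> B)}. ennreal (m ^ n) * indicator {\<omega> \<in> space M. card (P \<omega> \<inter> B) = n} \<omega>)"
      by (intro suminf_finite) auto
    with \<open>\<omega> \<in> space M\<close> show "ennreal (m ^ card (P \<omega> \<inter> B)) =
        (\<Sum>n. ennreal (m ^ n) * indicator {\<omega> \<in> space M. card (P \<omega> \<inter> B) = n} \<omega>)" by simp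
  qed
  also have "\<dots> = (\<Sum>n. ennreal (m ^ n) * emeasure M {\<omega> \<in> space M. card (P \<omega> \<inter> B) = n})"
    by (simp add: nn_integral_suminf nn_integral_cmult)
  also have "\<dots> = (\<Sum>n. ennreal ((m * v) ^ n / fact n * exp (- v)))"
    using m v by (simp add: emeasure_eq_measure count_poisson[OF B] v_def[symmetric] power_mult_distrib mult.assoc flip: ennreal_mult)
  also have "\<dots> = ennreal (exp (m * v) * exp (- v))"
  proof (rule suminf_ennreal_eq)
    show "(\<lambda>n. (m * v) ^ n / fact n * exp (- v)) sums (exp (m * v) * exp (- v))"
      using exp_converges[of "m * v"] by (intro sums_mult2) (simp add: divide_inverse mult.commute)
  qed (use m v in auto)
  also have "exp (m * v) * exp (- v) = exp (- (v * (1 - m)))"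
    by (simp add: algebra_simps flip: exp_add)
  finally show ?thesis by (simp add: v_def)
qed

text \<open>
  Conditional version of the void probability for a given configuration \<open>y\<close> of points: each radius belongs to
  exactly one set \<open>C q\<close>, so the probability is a product over the points, and it depends on
  \<open>y\<close> only through the counts.
\<close>

lemma (in spherical_boolean_model) radii_prob_void:
  fixes n :: nat
  assumes inj: "inj y" and fin: "\<And>q. q < n \<Longrightarrow> finite {k. y k \<in> C q}"
    and disj: "disjoint_family_on C {..<n}" and A: "\<And>q. q < n \<Longrightarrow> A q \<in> sets borel"
  shows "prob {\<omega> \<in> space M. \<forall>q<n. \<forall>k. y k \<in> C q \<longrightarrow> R k \<omega> \<in> A q} = (\<Prod>q<n. measure \<mu> (A q) ^ card (range y \<inter> C q))"
proof -
  note [measurable] = radii_measurable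
  define I where "I q = {k. y k \<in> C q}" for q
  define B where "B k = A (THE q. q < n \<and> y k \<in> C q)" for k
  have finI: "\<forall>q\<in>{..<n}. finite (I q)" using fin by (simp add: I_def)
  have disI: "\<forall>q\<in>{..<n}. \<forall>q'\<in>{..<n}. q \<noteq> q' \<longrightarrow> I q \<inter> I q' = {}"
    using disj unfolding I_def disjoint_family_on_def by blast
  have B: "B k = A q" if "q < n" "k \<in> I q" for q k
  proof -
    have "(THE q. q < n \<and> y k \<in> C q) = q"
      using that disI by (intro the_equality) (auto simp: I_def)
    then show ?thesis by (simp add: B_def)
  qed
  have card: "card (I q) = card (range y \<inter> C q)" for q
  proof -
    have "range y \<inter> C q = y ` I q" by (auto simp: I_def)
    then show ?thesis using inj by (simp add: card_image inj_on_subset)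
  qed
  have R: "prob (R k -` A q \<inter> space M) = measure \<mu> (A q)" if "q < n" for k q
    using A[OF that] measure_distr[of "R k" M borel "A q"] by (simp add: radii_distr)
  let ?J = "\<Union>q\<in>{..<n}. I q"
  have BJ: "B k \<in> sets borel" if "k \<in> ?J" for k
    using that A by (auto simp: B)
  have "{\<omega> \<in> space M. \<forall>q<n. \<forall>k. y k \<in> C q \<longrightarrow> R k \<omega> \<in> A q} = {\<omega> \<in> space M. \<forall>k\<in>?J. R k \<omega> \<in> B k}"
    by (auto simp: B) (auto simp: I_def B)
  also have "prob \<dots> = (\<Prod>k\<in>?J. prob (R k -` B k \<inter> space M))"
  proof (cases "?J = {}")
    case False
    have "{\<omega> \<in> space M. \<forall>k\<in>?J. R k \<omega> \<in> B k} = (\<Inter>k\<in>?J. R k -` B k \<inter> space M)"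
      using False by blast
    also have "prob \<dots> = (\<Prod>k\<in>?J. prob (R k -` B k \<inter> space M))"
      using finI BJ False by (intro indep_varsD[OF radii_indep]) auto
    finally show ?thesis .
  next
    case True
    then show ?thesis by (simp only: ball_empty True prod.empty) (simp add: prob_space)
  qed
  also have "\<dots> = (\<Prod>q<n. \<Prod>k\<in>I q. prob (R k -` B k \<inter> space M))"
    by (rule prod.UNION_disjoint[OF _ finI disI]) simp
  also have "\<dots> = (\<Prod>q<n. measure \<mu> (A q) ^ card (range y \<inter> C q))"
    by (intro prod.cong refl) (simp add: B R card)
  finally show ?thesis .
qed

text \<open>
  Conditioning on the points gives \<open>\<Prod>q<n. (measure \<mu> (A q)) ^ card (range y \<inter> C q)\<close>. The expectation
  of this product factorizes because the counts are independent, and each factor is a Poisson generating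
  function. This is the marking theorem for Poisson processes, restricted to void events.
\<close>

lemma (in spherical_boolean_model) marked_void_probability:
  fixes n :: nat
  assumes C: "\<And>q. q < n \<Longrightarrow> C q \<in> sets borel \<and> bounded (C q)"
    and disj: "disjoint_family_on C {..<n}" and A: "\<And>q. q < n \<Longrightarrow> A q \<in> sets borel"
  shows "prob {\<omega> \<in> space M. \<forall>q<n. \<forall>k. Y k \<omega> \<in> C q \<longrightarrow> R k \<omega> \<in> A q} =
     (\<Prod>q<n. exp (- (intensity * measure lborel (C q) * (1 - measure \<mu> (A q)))))"
proof -
  note [measurable] = radii_measurable points_measurable
  define NY where "NY = PiM UNIV (\<lambda>_::nat. borel :: 'a measure)"
  define NR where "NR = PiM UNIV (\<lambda>_::nat. borel :: real measure)"
  have YM [measurable]: "(\<lambda>\<omega> k. Y k \<omega>) \<in> measurable M NY"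
    unfolding NY_def by (rule measurable_PiM_single') auto
  have RM [measurable]: "(\<lambda>\<omega> k. R k \<omega>) \<in> measurable M NR"
    unfolding NR_def by (rule measurable_PiM_single') auto
  define S where "S = {p \<in> space (NY \<Otimes>\<^sub>M NR). \<forall>q\<in>{..<n}. \<forall>k. fst p k \<in> C q \<longrightarrow> snd p k \<in> A q}"
  have S: "S \<in> sets (NY \<Otimes>\<^sub>M NR)"
  proof -
    have "Measurable.pred (NY \<Otimes>\<^sub>M NR) (\<lambda>p. \<forall>q\<in>{..<n}. \<forall>k. fst p k \<in> C q \<longrightarrow> snd p k \<in> A q)"
    proof (rule measurable_pred_countable(1))
      fix q assume "q \<in> {..<n}"
      then have [measurable]: "C q \<in> sets borel" "A q \<in> sets borel" using C A by auto
      show "Measurable.pred (NY \<Otimes>\<^sub>M NR) (\<lambda>p. \<forall>k. fst p k \<in> C q \<longrightarrow> snd p k \<in> A q)"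
        unfolding NY_def NR_def by measurable
    qed simp
    then show ?thesis unfolding S_def pred_def .
  qed
  interpret RD: prob_space "distr M NR (\<lambda>\<omega> k. R k \<omega>)" by (rule prob_space_distr) (rule RM)
  have sp: "space NY = UNIV" "space NR = UNIV" by (auto simp: NY_def NR_def space_PiM)
  let ?ev = "{\<omega> \<in> space M. \<forall>q<n. \<forall>k. Y k \<omega> \<in> C q \<longrightarrow> R k \<omega> \<in> A q}"
  have ev: "?ev = (\<lambda>\<omega>. (\<lambda>k. Y k \<omega>, \<lambda>k. R k \<omega>)) -` S \<inter> space M"
    by (auto simp: S_def sp space_pair_measure)
  have "emeasure M ?ev = emeasure (distr M (NY \<Otimes>\<^sub>M NR) (\<lambda>\<omega>. (\<lambda>k. Y k \<omega>, \<lambda>k. R k \<omega>))) S"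
    unfolding ev using S by (subst emeasure_distr) auto
  also have "\<dots> = emeasure (distr M NY (\<lambda>\<omega> k. Y k \<omega>) \<Otimes>\<^sub>M distr M NR (\<lambda>\<omega> k. R k \<omega>)) S"
    using points_radii_indep YM RM
    by (subst joint_distr_of_indep_vimage) (auto simp: NY_def NR_def)
  also have "\<dots> = (\<integral>\<^sup>+ y. emeasure (distr M NR (\<lambda>\<omega> k. R k \<omega>)) (Pair y -` S) \<partial>distr M NY (\<lambda>\<omega> k. Y k \<omega>))"
    using S by (intro RD.emeasure_pair_measure_alt) (simp cong: sets_pair_measure_cong)
  also have "\<dots> = (\<integral>\<^sup>+ \<omega>. emeasure (distr M NR (\<lambda>\<omega> k. R k \<omega>)) (Pair (\<lambda>k. Y k \<omega>) -` S) \<partial>M)"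
    using S by (intro nn_integral_distr YM) (simp add: RD.measurable_emeasure_Pair cong: sets_pair_measure_cong)
  also have "\<dots> = (\<integral>\<^sup>+ \<omega>. (\<Prod>q<n. ennreal (measure \<mu> (A q) ^ card (range (\<lambda>k. Y k \<omega>) \<inter> C q))) \<partial>M)"
  proof (rule nn_integral_cong_AE)
    show "AE \<omega> in M. emeasure (distr M NR (\<lambda>\<omega> k. R k \<omega>)) (Pair (\<lambda>k. Y k \<omega>) -` S) =
      (\<Prod>q<n. ennreal (measure \<mu> (A q) ^ card (range (\<lambda>k. Y k \<omega>) \<inter> C q)))"
      using points_distinct locally_finite AE_space
    proof eventually_elim
      case (elim \<omega>)
      have "finite {k. Y k \<omega> \<in> C q}" if "q < n" for q
      proof -
        have "finite (range (\<lambda>k. Y k \<omega>) \<inter> C q)" using elim(2) C[OF that] by blast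
        then have "finite ((\<lambda>k. Y k \<omega>) -` (range (\<lambda>k. Y k \<omega>) \<inter> C q))"
          using elim(1) by (rule finite_vimageI)
        then show ?thesis by (simp add: vimage_def)
      qed
      note void = radii_prob_void[OF elim(1) this disj A]
      have "emeasure (distr M NR (\<lambda>\<omega> k. R k \<omega>)) (Pair (\<lambda>k. Y k \<omega>) -` S)
         = emeasure M ((\<lambda>\<omega> k. R k \<omega>) -` (Pair (\<lambda>k. Y k \<omega>) -` S) \<inter> space M)"
        using S by (intro emeasure_distr RM) (simp add: sets_Pair1)
      also have "(\<lambda>\<omega> k. R k \<omega>) -` (Pair (\<lambda>k. Y k \<omega>) -` S) \<inter> space M
         = {\<omega>' \<in> space M. \<forall>q<n. \<forall>k. Y k \<omega> \<in> C q \<longrightarrow> R k \<omega>' \<in> A q}"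
        by (auto simp: S_def sp space_pair_measure)
      finally show ?case by (simp add: emeasure_eq_measure void prod_ennreal)
    qed
  qed
  also have "\<dots> = (\<Prod>q<n. \<integral>\<^sup>+ \<omega>. ennreal (measure \<mu> (A q) ^ card (range (\<lambda>k. Y k \<omega>) \<inter> C q)) \<partial>M)"
    by (intro indep_vars_nn_integral indep_vars_compose2[OF count_indep[OF C disj]]) auto
  also have "\<dots> = (\<Prod>q<n. ennreal (exp (- (intensity * measure lborel (C q) * (1 - measure \<mu> (A q))))))"
    using C by (intro prod.cong refl nn_integral_power_count) auto
  finally show ?thesis by (simp add: emeasure_eq_measure prod_ennreal prod_nonneg)
qed

section \<open>The field of maximal radii per cell\<close>

text \<open>
  The supremum is taken in the extended reals, so that it is \<open>- \<infinity>\<close> on empty cells and no exceptional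
  set of configurations has to be removed for measurability.
\<close>

definition cell_radius ::
    "(nat \<Rightarrow> 'w \<Rightarrow> real ^ 'n) \<Rightarrow> (nat \<Rightarrow> 'w \<Rightarrow> real) \<Rightarrow> ('n \<Rightarrow> int) \<Rightarrow> 'w \<Rightarrow> ereal" where
  "cell_radius Y R q \<omega> = (SUP k. if cell_of (Y k \<omega>) = q then ereal (R k \<omega>) else - \<infinity>)"

lemma cell_radius_le_iff:
  "cell_radius Y R q \<omega> \<le> t \<longleftrightarrow> (\<forall>k. cell_of (Y k \<omega>) = q \<longrightarrow> ereal (R k \<omega>) \<le> t)"
  unfolding cell_radius_def SUP_le_iff by auto

definition cell :: "('n::finite \<Rightarrow> int) \<Rightarrow> (real ^ 'n) set" where
  "cell q = {y. cell_of y = q}"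

lemma cell_sets: "cell q \<in> sets borel"
proof -
  have "cell q = {y. \<forall>i. \<lfloor>y $ i\<rfloor> = q i}" by (auto simp: cell_def cell_of_def)
  also have "\<dots> \<in> sets borel" by measurable
  finally show ?thesis .
qed

lemma cell_subset_cbox: "cell q \<subseteq> cbox (\<chi> i. of_int (q i)) (\<chi> i. of_int (q i) + 1)"
  by (auto simp: cell_def cell_of_def mem_box_cart)

lemma bounded_cell: "bounded (cell q)"
  using bounded_cbox cell_subset_cbox by (rule bounded_subset)

lemma measure_cell_le_1: "measure lborel (cell q) \<le> 1"
proof -
  have "measure lborel (cell q) \<le> measure lborel (cbox (\<chi> i. real_of_int (q i)) (\<chi> i. real_of_int (q i) + 1))"
    by (rule measure_mono_fmeasurable[OF cell_subset_cbox]) (auto simp: cell_sets)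
  also have "\<dots> = 1" by (subst content_cbox_cart) (auto simp: interval_eq_empty_cart)
  finally show ?thesis .
qed

text \<open>
  The event says that no ball centred in a cell \<open>q\<close> of \<open>J\<close> has radius above \<open>t q\<close>, which is an
  instance of the marked void event.
\<close>

lemma prob_cell_radius_le:
  fixes Y :: "nat \<Rightarrow> 'w \<Rightarrow> real ^ 'n" and t :: "('n \<Rightarrow> int) \<Rightarrow> ereal"
  assumes "spherical_boolean_model M l Y R \<mu>" and J: "finite J"
  shows "measure M {\<omega> \<in> space M. \<forall>q\<in>J. cell_radius Y R q \<omega> \<le> t q} =
    (\<Prod>q\<in>J. exp (- (l * measure lborel (cell q) * (1 - measure \<mu> {r. ereal r \<le> t q}))))"
proof -
  interpret spherical_boolean_model M l Y R \<mu> by fact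
  obtain h where h: "bij_betw h {..<card J} J"
    using ex_bij_betw_nat_finite[OF J] by (auto simp: atLeast0LessThan)
  then have inj: "inj_on h {..<card J}" and im: "J = h ` {..<card J}" by (auto simp: bij_betw_def)
  have "{\<omega> \<in> space M. \<forall>q\<in>J. cell_radius Y R q \<omega> \<le> t q} =
     {\<omega> \<in> space M. \<forall>i<card J. \<forall>k. Y k \<omega> \<in> cell (h i) \<longrightarrow> R k \<omega> \<in> {r. ereal r \<le> t (h i)}}"
    by (subst im) (auto simp: cell_radius_le_iff cell_def)
  also have "prob \<dots> = (\<Prod>i<card J. exp (- (l * measure lborel (cell (h i)) * (1 - measure \<mu> {r. ereal r \<le> t (h i)}))))"
  proof (rule marked_void_probability)
    show "disjoint_family_on (\<lambda>i. cell (h i)) {..<card J}"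
      using inj by (auto simp: disjoint_family_on_def cell_def inj_on_def)
  qed (auto simp: cell_sets bounded_cell)
  also have "\<dots> = (\<Prod>q\<in>J. exp (- (l * measure lborel (cell q) * (1 - measure \<mu> {r. ereal r \<le> t q}))))"
    by (rule prod.reindex_bij_betw[OF h])
  finally show ?thesis .
qed

lemma cell_radius_measurable:
  fixes Y :: "nat \<Rightarrow> 'w \<Rightarrow> real ^ 'n"
  assumes "spherical_boolean_model M l Y R \<mu>"
  shows "cell_radius Y R q \<in> borel_measurable M"
proof -
  interpret spherical_boolean_model M l Y R \<mu> by fact
  note [measurable] = points_measurable radii_measurable cell_sets
  have "(\<lambda>\<omega>. if Y k \<omega> \<in> cell q then ereal (R k \<omega>) else - \<infinity>) \<in> borel_measurable M" for k by measurable
  then have "(\<lambda>\<omega>. SUP k. if Y k \<omega> \<in> cell q then ereal (R k \<omega>) else - \<infinity>) \<in> borel_measurable M" by measurable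
  then show ?thesis by (simp add: cell_radius_def[abs_def] cell_def)
qed

text \<open>
  The joint distribution function factorizes by the previous formula, and the half-lines \<open>{..t}\<close> form
  an intersection-stable generator of the Borel sets.
\<close>

lemma indep_vars_cell_radius:
  fixes Y :: "nat \<Rightarrow> 'w \<Rightarrow> real ^ 'n"
  assumes model: "spherical_boolean_model M l Y R \<mu>"
  shows "prob_space.indep_vars M (\<lambda>_. borel) (cell_radius Y R) UNIV"
proof -
  interpret spherical_boolean_model M l Y R \<mu> by fact
  let ?X = "cell_radius Y R"
  let ?le = "\<lambda>q t. {\<omega> \<in> space M. ?X q \<omega> \<le> t}"
  note [measurable] = cell_radius_measurable[OF model]
  have "indep_sets (\<lambda>q. range (?le q)) UNIV"
  proof (rule indep_setsI)
    show "range (?le q) \<subseteq> events" for q by auto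
    fix A J assume J: "J \<noteq> {}" "finite J" and A: "\<forall>q\<in>J. A q \<in> range (?le q)"
    then obtain t where t: "\<And>q. q \<in> J \<Longrightarrow> A q = ?le q (t q)" by (auto simp: image_iff) metis
    have "(\<Inter>q\<in>J. A q) = {\<omega> \<in> space M. \<forall>q\<in>J. ?X q \<omega> \<le> t q}" using t J by auto
    also have "prob \<dots> = (\<Prod>q\<in>J. prob {\<omega> \<in> space M. \<forall>q\<in>{q}. ?X q \<omega> \<le> t q})"
      using J by (simp only: prob_cell_radius_le[OF model] finite.intros) simp
    finally show "prob (\<Inter>q\<in>J. A q) = (\<Prod>q\<in>J. prob (A q))" using t by simp
  qed
  then have "indep_sets (\<lambda>q. sigma_sets (space M) (range (?le q))) UNIV"
  proof (rule indep_sets_sigma)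
    fix q
    have min: "?le q s \<inter> ?le q t = ?le q (min s t)" for s t by auto
    show "Int_stable (range (?le q))" unfolding Int_stable_def by (auto simp only: min intro: rangeI)
  qed
  moreover have "{?X q -` A \<inter> space M |A. A \<in> sets borel} \<subseteq> sigma_sets (space M) (range (?le q))" for q
  proof -
    let ?S = "sigma (space M) (range (?le q))"
    have "?X q \<in> borel_measurable ?S"
      by (rule borel_measurableI_le) (auto simp: sets_measure_of_conv space_measure_of_conv)
    then have "?X q -` A \<inter> space ?S \<in> sets ?S" if "A \<in> sets borel" for A using that by (rule measurable_sets)
    moreover have "range (?le q) \<subseteq> Pow (space M)" by auto
    ultimately show ?thesis by (auto simp: space_measure_of_conv)
  qed
  ultimately have "indep_sets (\<lambda>q. {?X q -` A \<inter> space M |A. A \<in> sets borel}) UNIV"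
    by (rule indep_sets_mono_sets)
  then show ?thesis unfolding indep_vars_def2 by simp
qed

lemma prob_cell_radius_greater:
  fixes Y :: "nat \<Rightarrow> 'w \<Rightarrow> real ^ 'n"
  assumes model: "spherical_boolean_model M l Y R \<mu>" and "prob_space \<mu>" and \<mu>: "sets \<mu> = sets borel"
  shows "measure M {\<omega> \<in> space M. ereal t < cell_radius Y R q \<omega>} \<le> l * measure \<mu> {t<..}"
proof -
  interpret spherical_boolean_model M l Y R \<mu> by fact
  interpret \<mu>: prob_space \<mu> by fact
  note [measurable] = cell_radius_measurable[OF model]
  let ?v = "measure lborel (cell q)"
  have sp: "space \<mu> = UNIV" using sets_eq_imp_space_eq[OF \<mu>] by simp
  have tail: "1 - measure \<mu> {r. ereal r \<le> ereal t} = measure \<mu> {t<..}"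
  proof -
    have "{t<..} = space \<mu> - {r. ereal r \<le> ereal t}" by (auto simp: sp)
    then show ?thesis by (simp add: \<mu>.prob_compl \<mu> atMost_def[symmetric])
  qed
  have "{\<omega> \<in> space M. ereal t < cell_radius Y R q \<omega>} =
      space M - {\<omega> \<in> space M. \<forall>q\<in>{q}. cell_radius Y R q \<omega> \<le> ereal t}" by auto
  then have "prob {\<omega> \<in> space M. ereal t < cell_radius Y R q \<omega>} = 1 - exp (- (l * ?v * measure \<mu> {t<..}))"
    using prob_cell_radius_le[OF model, of "{q}" "\<lambda>_. ereal t"] by (simp add: prob_compl tail[simplified])
  also have "\<dots> \<le> l * ?v * measure \<mu> {t<..}"
    using exp_ge_add_one_self[of "- (l * ?v * measure \<mu> {t<..})"] by linarith
  also have "\<dots> \<le> l * 1 * measure \<mu> {t<..}"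
    using intensity_pos measure_cell_le_1 by (intro mult_right_mono mult_left_mono) auto
  finally show ?thesis by simp
qed

section \<open>Locality and independence of crossings\<close>

lemma link_cong:
  assumes "\<And>s. s \<in> S \<Longrightarrow> f s = g s"
  shows "link f S = link g S"
  using assms by (auto simp: link_def)

lemma crossing_cong:
  assumes "\<And>s. ldist s c \<le> 3 * r \<Longrightarrow> f s = g s"
  shows "crossing f c r = crossing g c r"
proof -
  have "{s. ldist s c \<le> 3 * r \<and> f s \<le> ereal (of_int r / 16)} = {s. ldist s c \<le> 3 * r \<and> g s \<le> ereal (of_int r / 16)}"
    using assms by auto
  moreover have "link f {s. ldist s c \<le> 3 * r \<and> g s \<le> ereal (of_int r / 16)} =
      link g {s. ldist s c \<le> 3 * r \<and> g s \<le> ereal (of_int r / 16)}"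
    using assms by (intro link_cong) auto
  ultimately show ?thesis by (simp add: crossing_def)
qed

text \<open>
  Lattice chains of length \<open>n\<close> are countable in number, hence the quantifiers over the chain are countable.
\<close>

lemma measurable_crossing:
  fixes X :: "('n::finite \<Rightarrow> int) \<Rightarrow> 'w \<Rightarrow> ereal"
  assumes X: "\<And>q. ldist q c \<le> 3 * r \<Longrightarrow> X q \<in> borel_measurable M"
  shows "Measurable.pred M (\<lambda>\<omega>. crossing (\<lambda>q. X q \<omega>) c r)"
proof -
  define E where "E \<omega> = link (\<lambda>q. X q \<omega>) {s. ldist s c \<le> 3 * r \<and> X s \<omega> \<le> ereal (of_int r / 16)}" for \<omega>
  have E: "Measurable.pred M (\<lambda>\<omega>. (p, q) \<in> E \<omega>)" for p q
  proof (cases "ldist p c \<le> 3 * r \<and> ldist q c \<le> 3 * r")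
    case True
    then have [measurable]: "X p \<in> borel_measurable M" "X q \<in> borel_measurable M" using X by auto
    show ?thesis unfolding E_def link_def using True by simp
  next
    case False
    then have "(p, q) \<in> E \<omega> \<longleftrightarrow> False" for \<omega> by (auto simp: E_def link_def)
    then show ?thesis by simp
  qed
  have "Measurable.pred M (\<lambda>\<omega>. (p, q) \<in> E \<omega> ^^ n)" for p q n
  proof (induction n arbitrary: q)
    case (Suc n)
    have "(p, q) \<in> E \<omega> ^^ Suc n \<longleftrightarrow> (\<exists>s. (p, s) \<in> E \<omega> ^^ n \<and> (s, q) \<in> E \<omega>)" for \<omega> by auto
    then show ?case using Suc E by simp
  qed simp
  note [measurable] = this
  have "crossing (\<lambda>q. X q \<omega>) c r \<longleftrightarrow>
     (\<exists>p q n. ldist p c \<le> r \<and> 2 * r \<le> ldist q c \<and> (p, q) \<in> E \<omega> ^^ n)" for \<omega>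
    unfolding crossing_def E_def[symmetric] rtrancl_power by blast
  then show ?thesis by simp
qed

lemma (in prob_space) prob_Bex_le:
  assumes F: "finite F" and ev: "\<And>q. q \<in> F \<Longrightarrow> Measurable.pred M (P q)"
    and b: "\<And>q. q \<in> F \<Longrightarrow> prob {\<omega> \<in> space M. P q \<omega>} \<le> b"
  shows "prob {\<omega> \<in> space M. \<exists>q\<in>F. P q \<omega>} \<le> of_nat (card F) * b"
proof -
  have "{\<omega> \<in> space M. \<exists>q\<in>F. P q \<omega>} = (\<Union>q\<in>F. {\<omega> \<in> space M. P q \<omega>})" by auto
  also have "prob \<dots> \<le> (\<Sum>q\<in>F. prob {\<omega> \<in> space M. P q \<omega>})"
    using F ev by (intro finite_measure_subadditive_finite) (auto simp: pred_def)
  also have "\<dots> \<le> of_nat (card F) * b" using b by (rule sum_bounded_above)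
  finally show ?thesis .
qed

lemma (in prob_space) prob_two_crossings:
  fixes X :: "('n::finite \<Rightarrow> int) \<Rightarrow> 'a \<Rightarrow> ereal"
  assumes X: "indep_vars (\<lambda>_. borel) X UNIV" and far: "6 * r < ldist c c'"
  shows "prob {\<omega> \<in> space M. crossing (\<lambda>q. X q \<omega>) c r \<and> crossing (\<lambda>q. X q \<omega>) c' r} =
    prob {\<omega> \<in> space M. crossing (\<lambda>q. X q \<omega>) c r} * prob {\<omega> \<in> space M. crossing (\<lambda>q. X q \<omega>) c' r}"
proof -
  define Q where "Q c = {q::'n \<Rightarrow> int. ldist q c \<le> 3 * r}" for c
  define N where "N c = PiM (Q c) (\<lambda>_. borel :: ereal measure)" for c
  define V where "V c \<omega> = restrict (\<lambda>q. X q \<omega>) (Q c)" for c \<omega>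
  define H where "H c = {f \<in> space (N c). crossing f c r}" for c
  have "Q c \<inter> Q c' = {}"
  proof -
    have "ldist c c' \<le> ldist q c + ldist q c'" for q
      using ldist_triangle[of c c' q] ldist_commute[of c q] by simp
    then show ?thesis using far unfolding Q_def by (smt (verit) disjoint_iff mem_Collect_eq)
  qed
  then have ind: "indep_var (N c) (V c) (N c') (V c')"
    unfolding N_def V_def using indep_var_restrict[OF X] by simp
  have H: "H c \<in> sets (N c)" for c
  proof -
    have "Measurable.pred (N c) (\<lambda>f. crossing (\<lambda>q. f q) c r)"
      by (rule measurable_crossing) (auto simp: N_def Q_def)
    then show ?thesis by (simp add: H_def pred_def)
  qed
  have VH: "V c \<omega> \<in> H c \<longleftrightarrow> crossing (\<lambda>q. X q \<omega>) c r" for c \<omega>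
  proof -
    have "crossing (V c \<omega>) c r = crossing (\<lambda>q. X q \<omega>) c r"
      by (rule crossing_cong) (simp add: V_def Q_def)
    then show ?thesis by (simp add: H_def N_def V_def space_PiM)
  qed
  have "{\<omega> \<in> space M. crossing (\<lambda>q. X q \<omega>) c r \<and> crossing (\<lambda>q. X q \<omega>) c' r} =
      (\<lambda>\<omega>. (V c \<omega>, V c' \<omega>)) -` (H c \<times> H c') \<inter> space M"
    by (auto simp: VH)
  also have "prob \<dots> = prob (V c -` H c \<inter> space M) * prob (V c' -` H c' \<inter> space M)"
    by (rule indep_varD[OF ind H H])
  finally show ?thesis by (simp add: vimage_def Int_def VH conj_commute)
qed

section \<open>The multiscale estimate\<close>

lemma card_ldist_cube_le:
  assumes "0 \<le> r" "2 * r + 1 \<le> m"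
  shows "real (card {q::'n::finite \<Rightarrow> int. ldist q c \<le> r}) \<le> of_int m ^ CARD('n)"
proof -
  have "real (card {q::'n \<Rightarrow> int. ldist q c \<le> r}) = of_int (2 * r + 1) ^ CARD('n)"
    using assms(1) by (simp add: card_ldist_cube)
  also have "\<dots> \<le> of_int m ^ CARD('n)"
    using assms by (intro power_mono) (simp_all only: of_int_le_iff of_int_0_le_iff)
  finally show ?thesis .
qed

lemma crossing_active:
  assumes "crossing f c r" "0 < r"
  obtains q where "ldist q c \<le> 3 * r" "- 1 < f q"
proof -
  let ?S = "{s. ldist s c \<le> 3 * r \<and> f s \<le> ereal (of_int r / 16)}"
  obtain p q where pq: "ldist p c \<le> r" "2 * r \<le> ldist q c" "(p, q) \<in> (link f ?S)\<^sup>*"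
    using assms(1) unfolding crossing_def by blast
  then have "p \<noteq> q" using assms(2) by auto
  then obtain s where "(p, s) \<in> link f ?S" using pq(3) by (meson converse_rtranclE)
  then show thesis using that by (auto simp: link_def)
qed

text \<open>
  Either some site of the larger cube is too large for scale \<open>r\<close>, which costs the number of sites
  times \<open>w\<close>, or the crossing splits into two independent ones, each with at most \<open>75 ^ CARD('n)\<close>
  possible centres.
\<close>

lemma (in prob_space) prob_crossing_recursion:
  fixes X :: "('n::finite \<Rightarrow> int) \<Rightarrow> 'a \<Rightarrow> ereal"
  assumes X: "indep_vars (\<lambda>_. borel) X UNIV" and r: "8 \<le> r"
    and u: "\<And>c. prob {\<omega> \<in> space M. crossing (\<lambda>q. X q \<omega>) c r} \<le> u"
    and w: "\<And>q. prob {\<omega> \<in> space M. ereal (of_int r / 16) < X q \<omega>} \<le> w"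
  shows "prob {\<omega> \<in> space M. crossing (\<lambda>q. X q \<omega>) c (20 * r)} \<le>
    (75 ^ CARD('n))\<^sup>2 * u\<^sup>2 + (121 * of_int r) ^ CARD('n) * w"
proof -
  have [measurable]: "X q \<in> borel_measurable M" for q using X by (simp add: indep_vars_def)
  have [measurable]: "Measurable.pred M (\<lambda>\<omega>. crossing (\<lambda>q. X q \<omega>) c r)" for c r
    by (rule measurable_crossing) measurable
  have u0: "0 \<le> u" using u[of undefined] measure_nonneg order_trans by blast
  have w0: "0 \<le> w" using w[of undefined] measure_nonneg order_trans by blast
  define F where "F = {q. ldist q c \<le> 60 * r}"
  define G where "G = subgrid c 37 r"
  define D where "D = {p \<in> G \<times> G. 6 * r < ldist (fst p) (snd p)}"
  define A where "A = {\<omega> \<in> space M. \<exists>q\<in>F. ereal (of_int r / 16) < X q \<omega>}"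
  define B where "B = {\<omega> \<in> space M. \<exists>p\<in>D. crossing (\<lambda>q. X q \<omega>) (fst p) r \<and> crossing (\<lambda>q. X q \<omega>) (snd p) r}"
  have fin: "finite F" "finite G" "finite D"
    by (auto simp: F_def G_def D_def finite_ldist_cube finite_subgrid)
  have [measurable]: "A \<in> events" "B \<in> events"
    unfolding A_def B_def using fin by (auto intro!: sets.sets_Collect_finite_Ex)
  have "{\<omega> \<in> space M. crossing (\<lambda>q. X q \<omega>) c (20 * r)} \<subseteq> A \<union> B"
  proof
    fix \<omega> assume \<omega>: "\<omega> \<in> {\<omega> \<in> space M. crossing (\<lambda>q. X q \<omega>) c (20 * r)}"
    show "\<omega> \<in> A \<union> B"
    proof (cases "\<omega> \<in> A")
      case False
      then have "X s \<omega> \<le> ereal (of_int r / 16)" if "ldist s c \<le> 60 * r" for s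
        using \<omega> that by (auto simp: A_def F_def not_less)
      then obtain c1 c2 where "c1 \<in> G" "c2 \<in> G" "6 * r < ldist c1 c2"
          "crossing (\<lambda>q. X q \<omega>) c1 r" "crossing (\<lambda>q. X q \<omega>) c2 r"
        using crossing_splits[OF r, of "\<lambda>q. X q \<omega>" c] \<omega> unfolding G_def by blast
      then show ?thesis using \<omega> by (auto simp: B_def D_def intro!: bexI[of _ "(c1, c2)"])
    qed simp
  qed
  then have "prob {\<omega> \<in> space M. crossing (\<lambda>q. X q \<omega>) c (20 * r)} \<le> prob (A \<union> B)"
    by (rule finite_measure_mono) simp
  also have "\<dots> \<le> prob A + prob B" by (rule measure_Un_le) simp_all
  also have "prob B \<le> real (card D) * u\<^sup>2"
    unfolding B_def
  proof (rule prob_Bex_le[OF fin(3)])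
    fix p assume "p \<in> D"
    then have "6 * r < ldist (fst p) (snd p)" by (simp add: D_def)
    from prob_two_crossings[OF X this]
    show "prob {\<omega> \<in> space M. crossing (\<lambda>q. X q \<omega>) (fst p) r \<and> crossing (\<lambda>q. X q \<omega>) (snd p) r} \<le> u\<^sup>2"
      using u u0 by (simp add: power2_eq_square mult_mono)
  qed simp
  also have "real (card D) * u\<^sup>2 \<le> (75 ^ CARD('n))\<^sup>2 * u\<^sup>2"
  proof (rule mult_right_mono)
    have "card G \<le> 75 ^ CARD('n)" unfolding G_def using card_subgrid[of c 37 r] by simp
    moreover have "card D \<le> card (G \<times> G)" using fin by (intro card_mono) (auto simp: D_def)
    ultimately have "card D \<le> (75 ^ CARD('n))\<^sup>2"
      by (simp add: card_cartesian_product power2_eq_square mult_le_mono order_trans)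
    from of_nat_mono[OF this, where 'a = real] show "real (card D) \<le> (75 ^ CARD('n))\<^sup>2" by simp
  qed simp
  also have "prob A \<le> real (card F) * w"
    unfolding A_def using fin w by (intro prob_Bex_le) auto
  also have "real (card F) * w \<le> (121 * of_int r) ^ CARD('n) * w"
    using card_ldist_cube_le[of "60 * r" "121 * r" c] r w0 by (intro mult_right_mono) (auto simp: F_def)
  finally show ?thesis by simp
qed

text \<open>
  Majorizes the crossing probabilities, up to the factor \<open>l\<close>, once the quadratic term of their recursion
  is absorbed into half of the previous bound.
\<close>

primrec halving_sum :: "real \<Rightarrow> (nat \<Rightarrow> real) \<Rightarrow> nat \<Rightarrow> real" where
  "halving_sum a b 0 = a"
| "halving_sum a b (Suc k) = halving_sum a b k / 2 + b (Suc k)"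

text \<open>
  The left-hand side grows by exactly \<open>2 * b (Suc n)\<close> in a step, which bounds at once the values and
  their sum by the sum of \<open>b\<close>.
\<close>

lemma sum_halving_sum:
  "(\<Sum>k<n. halving_sum a b k) + 2 * halving_sum a b n = 2 * (a + (\<Sum>k<n. b (Suc k)))"
  by (induction n) auto

lemma halving_sum_nonneg: "0 \<le> a \<Longrightarrow> (\<And>k. 0 \<le> b k) \<Longrightarrow> 0 \<le> halving_sum a b n"
  by (induction n) auto

lemma
  assumes a: "0 \<le> a" and b: "\<And>k. 0 \<le> b k" "summable b"
  shows halving_sum_le: "halving_sum a b n \<le> 2 * (a + suminf b)"
    and sum_halving_sum_le: "(\<Sum>k<n. halving_sum a b k) \<le> 2 * (a + suminf b)"
proof -
  have "(\<Sum>k<n. b (Suc k)) \<le> (\<Sum>k<Suc n. b k)" using b by (subst sum.lessThan_Suc_shift) simp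
  also have "\<dots> \<le> suminf b" using b by (intro sum_le_suminf) auto
  finally have 1: "(\<Sum>k<n. halving_sum a b k) + 2 * halving_sum a b n \<le> 2 * (a + suminf b)"
    by (simp add: sum_halving_sum)
  have 2: "0 \<le> halving_sum a b n" "0 \<le> (\<Sum>k<n. halving_sum a b k)"
    using a b by (auto intro!: halving_sum_nonneg sum_nonneg)
  show "halving_sum a b n \<le> 2 * (a + suminf b)" "(\<Sum>k<n. halving_sum a b k) \<le> 2 * (a + suminf b)"
    using 1 2 by linarith+
qed

text \<open>
  At the lowest scale a crossing needs an occupied cell among boundedly many. In the induction step the
  smallness of \<open>l\<close> turns the quadratic term of the recursion into half of the previous bound. The
  threshold \<open>20 ^ k / 8000\<close> is lower than the recursion requires; it is used so that the same
  series \<open>b\<close> also controls the balls comparable to their distance from the origin.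
\<close>

lemma (in prob_space) prob_crossing_le_halving_sum:
  fixes X :: "('n::finite \<Rightarrow> int) \<Rightarrow> 'a \<Rightarrow> ereal" and T :: "real \<Rightarrow> real"
  defines "b \<equiv> \<lambda>k. (121 * 20 ^ k) ^ CARD('n) * T (20 ^ k / 8000)"
  assumes X: "indep_vars (\<lambda>_. borel) X UNIV" and l: "0 \<le> l"
    and T: "\<And>t. 0 \<le> T t" "T (- 1) \<le> 1" "antimono T"
    and tail: "\<And>q t. prob {\<omega> \<in> space M. ereal t < X q \<omega>} \<le> l * T t"
    and summable: "summable b"
    and small: "(75 ^ CARD('n))\<^sup>2 * (l * (2 * (121 ^ CARD('n) + suminf b))) \<le> 1 / 2"
  shows "prob {\<omega> \<in> space M. crossing (\<lambda>q. X q \<omega>) c (20 ^ Suc k)} \<le> l * halving_sum (121 ^ CARD('n)) b k"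
proof (induction k arbitrary: c)
  case 0
  have [measurable]: "X q \<in> borel_measurable M" for q using X by (simp add: indep_vars_def)
  have "{\<omega> \<in> space M. crossing (\<lambda>q. X q \<omega>) c (20 ^ Suc 0)} \<subseteq>
     {\<omega> \<in> space M. \<exists>q\<in>{q. ldist q c \<le> 60}. ereal (- 1) < X q \<omega>}"
    by (auto elim!: crossing_active simp: one_ereal_def)
  then have "prob {\<omega> \<in> space M. crossing (\<lambda>q. X q \<omega>) c (20 ^ Suc 0)} \<le>
     prob {\<omega> \<in> space M. \<exists>q\<in>{q. ldist q c \<le> 60}. ereal (- 1) < X q \<omega>}"
    by (rule finite_measure_mono) (intro sets.sets_Collect_finite_Ex finite_ldist_cube, measurable)
  also have "\<dots> \<le> real (card {q::'n \<Rightarrow> int. ldist q c \<le> 60}) * (l * T (- 1))"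
    using tail by (intro prob_Bex_le finite_ldist_cube) auto
  also have "\<dots> \<le> 121 ^ CARD('n) * (l * 1)"
    using card_ldist_cube_le[of 60 121 c] l T by (intro mult_mono) auto
  finally show ?case by (simp add: mult.commute)
next
  case (Suc k)
  define a :: real where "a = 121 ^ CARD('n)"
  define s where "s = halving_sum a b k"
  have b0: "0 \<le> b k" for k using T by (simp add: b_def)
  have s0: "0 \<le> s" unfolding s_def using b0 by (intro halving_sum_nonneg) (auto simp: a_def)
  have "s \<le> 2 * (a + suminf b)"
    unfolding s_def using b0 summable by (intro halving_sum_le) (auto simp: a_def)
  then have "(75 ^ CARD('n))\<^sup>2 * (l * s) \<le> (75 ^ CARD('n))\<^sup>2 * (l * (2 * (a + suminf b)))"
    using l by (intro mult_left_mono) auto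
  then have half: "(75 ^ CARD('n))\<^sup>2 * (l * s) \<le> 1 / 2"
    using small unfolding a_def by (rule order_trans)
  have "(1::int) \<le> 20 ^ k" by simp
  then have r: "(8::int) \<le> 20 ^ Suc k" unfolding power_Suc by linarith
  have w: "prob {\<omega> \<in> space M. ereal (of_int (20 ^ Suc k) / 16) < X q \<omega>} \<le> l * T (20 ^ Suc k / 8000)" for q
  proof -
    have "T (of_int (20 ^ Suc k) / 16) \<le> T (20 ^ Suc k / 8000)"
      using T(3) by (rule antimonoD) (auto simp: field_simps)
    then show ?thesis using tail[of "of_int (20 ^ Suc k) / 16" q] l by (meson mult_left_mono order_trans)
  qed
  have "prob {\<omega> \<in> space M. crossing (\<lambda>q. X q \<omega>) c (20 * 20 ^ Suc k)} \<le>
    (75 ^ CARD('n))\<^sup>2 * (l * s)\<^sup>2 + (121 * of_int (20 ^ Suc k)) ^ CARD('n) * (l * T (20 ^ Suc k / 8000))"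
    by (rule prob_crossing_recursion[OF X r _ w]) (use Suc in \<open>simp add: s_def a_def\<close>)
  also have "(75 ^ CARD('n))\<^sup>2 * (l * s)\<^sup>2 = ((75 ^ CARD('n))\<^sup>2 * (l * s)) * (l * s)"
    by (simp add: power2_eq_square mult.assoc)
  also have "\<dots> \<le> 1 / 2 * (l * s)" using half l s0 by (intro mult_right_mono) auto
  also have "1 / 2 * (l * s) + (121 * of_int (20 ^ Suc k)) ^ CARD('n) * (l * T (20 ^ Suc k / 8000)) =
      l * halving_sum a b (Suc k)"
  proof -
    have "1 / 2 * (l * s) + B * (l * t) = l * (s / 2 + B * t)" for B t by (simp add: algebra_simps)
    then show ?thesis by (simp only: halving_sum.simps b_def s_def of_int_power of_int_numeral)
  qed
  finally show ?case by (simp add: a_def)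
qed

section \<open>Unblocked fields\<close>

text \<open>
  The exceptional event at the origin: the failure, at some scale, of one of the hypotheses
  of \<open>vacant_percolates_if_no_crossing\<close>.
\<close>

definition blocked :: "(('n::finite \<Rightarrow> int) \<Rightarrow> ereal) \<Rightarrow> bool" where
  "blocked f \<longleftrightarrow> (\<exists>q\<in>{q. ldist q (\<lambda>_. 0) \<le> 20 ^ 3}. ereal (- 1) < f q) \<or>
     (\<exists>k. (\<exists>q\<in>{q. ldist q (\<lambda>_. 0) \<le> 20 ^ Suc k}. ereal (20 ^ k / 8000) < f q) \<or>
        (\<exists>c\<in>subgrid (\<lambda>_. 0) 400 (20 ^ Suc k). crossing f c (20 ^ Suc k)))"

text \<open>
  A union bound over all scales. It converges because both the weighted tails \<open>b k\<close> and the crossing bounds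
  are summable, and each summand is proportional to \<open>l\<close>.
\<close>

lemma (in prob_space) prob_blocked:
  fixes X :: "('n::finite \<Rightarrow> int) \<Rightarrow> 'a \<Rightarrow> ereal" and T :: "real \<Rightarrow> real"
  defines "b \<equiv> \<lambda>k. (121 * 20 ^ k) ^ CARD('n) * T (20 ^ k / 8000)"
  assumes X: "indep_vars (\<lambda>_. borel) X UNIV" and l: "0 \<le> l"
    and T: "\<And>t. 0 \<le> T t" "T (- 1) \<le> 1" "antimono T"
    and tail: "\<And>q t. prob {\<omega> \<in> space M. ereal t < X q \<omega>} \<le> l * T t"
    and summable: "summable b"
    and small: "(75 ^ CARD('n))\<^sup>2 * (l * (2 * (121 ^ CARD('n) + suminf b))) \<le> 1 / 2"
  shows "Measurable.pred M (\<lambda>\<omega>. blocked (\<lambda>q. X q \<omega>))"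
    and "prob {\<omega> \<in> space M. blocked (\<lambda>q. X q \<omega>)} \<le>
      l * (16001 ^ CARD('n) + suminf b + 801 ^ CARD('n) * (2 * (121 ^ CARD('n) + suminf b)))"
proof -
  have [measurable]: "X q \<in> borel_measurable M" for q using X by (simp add: indep_vars_def)
  have [measurable]: "Measurable.pred M (\<lambda>\<omega>. crossing (\<lambda>q. X q \<omega>) c r)" for c r
    by (rule measurable_crossing) measurable
  define a :: real where "a = 121 ^ CARD('n)"
  define h where "h = halving_sum a b"
  have b0: "0 \<le> b k" for k using T by (simp add: b_def)
  have a0: "0 \<le> a" by (simp add: a_def)
  define A where "A = {\<omega> \<in> space M. \<exists>q\<in>{q. ldist q (\<lambda>_. 0) \<le> 20 ^ 3}. ereal (- 1) < X q \<omega>}"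
  define B where "B k = {\<omega> \<in> space M. \<exists>q\<in>{q. ldist q (\<lambda>_. 0) \<le> 20 ^ Suc k}. ereal (20 ^ k / 8000) < X q \<omega>}" for k
  define C where "C k = {\<omega> \<in> space M. \<exists>c\<in>subgrid (\<lambda>_. 0) 400 (20 ^ Suc k). crossing (\<lambda>q. X q \<omega>) c (20 ^ Suc k)}" for k
  have [measurable]: "A \<in> events" "B k \<in> events" "C k \<in> events" for k
    unfolding A_def B_def C_def
    by (intro sets.sets_Collect_finite_Ex finite_ldist_cube finite_subgrid; measurable)+
  have bl: "{\<omega> \<in> space M. blocked (\<lambda>q. X q \<omega>)} = A \<union> (\<Union>k. B k \<union> C k)"
    by (auto simp: blocked_def A_def B_def C_def)
  have "A \<union> (\<Union>k. B k \<union> C k) \<in> events" by measurable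
  then show "Measurable.pred M (\<lambda>\<omega>. blocked (\<lambda>q. X q \<omega>))" by (simp add: pred_def bl)
  have A: "prob A \<le> l * 16001 ^ CARD('n)"
  proof -
    have "prob A \<le> real (card {q::'n \<Rightarrow> int. ldist q (\<lambda>_. 0) \<le> 20 ^ 3}) * (l * T (- 1))"
      unfolding A_def using tail by (intro prob_Bex_le finite_ldist_cube) auto
    also have "\<dots> \<le> 16001 ^ CARD('n) * (l * 1)"
      using card_ldist_cube_le[of "20 ^ 3" 16001 "\<lambda>_::'n. 0"] l T by (intro mult_mono) auto
    finally show ?thesis by (simp add: mult.commute)
  qed
  have B: "prob (B k) \<le> l * b k" for k
  proof -
    have "(1::int) \<le> 20 ^ k" by simp
    then have side: "2 * 20 ^ Suc k + 1 \<le> 121 * (20::int) ^ k" unfolding power_Suc by linarith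
    have "prob (B k) \<le> real (card {q::'n \<Rightarrow> int. ldist q (\<lambda>_. 0) \<le> 20 ^ Suc k}) * (l * T (20 ^ k / 8000))"
      unfolding B_def using tail by (intro prob_Bex_le finite_ldist_cube) auto
    also have "\<dots> \<le> of_int (121 * 20 ^ k) ^ CARD('n) * (l * T (20 ^ k / 8000))"
      using l T by (intro mult_right_mono card_ldist_cube_le side mult_nonneg_nonneg) auto
    finally show ?thesis by (simp add: b_def mult_ac)
  qed
  have C: "prob (C k) \<le> 801 ^ CARD('n) * (l * h k)" for k
  proof -
    have "prob (C k) \<le> real (card (subgrid (\<lambda>_::'n. 0) 400 (20 ^ Suc k))) * (l * h k)"
      unfolding C_def h_def a_def
    proof (rule prob_Bex_le[OF finite_subgrid])
      show "prob {\<omega> \<in> space M. crossing (\<lambda>q. X q \<omega>) c (20 ^ Suc k)} \<le> l * halving_sum (121 ^ CARD('n)) b k" for c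
        unfolding b_def using summable small unfolding b_def by (intro prob_crossing_le_halving_sum X l T tail)
    qed simp
    also have "\<dots> \<le> 801 ^ CARD('n) * (l * h k)"
    proof (rule mult_right_mono)
      show "real (card (subgrid (\<lambda>_::'n. 0) 400 (20 ^ Suc k))) \<le> 801 ^ CARD('n)"
        using of_nat_mono[OF card_subgrid[of "\<lambda>_::'n. 0" 400 "20 ^ Suc k"], where 'a = real] by simp
      show "0 \<le> l * h k" using l b0 a0 by (auto simp: h_def intro!: halving_sum_nonneg mult_nonneg_nonneg)
    qed
    finally show ?thesis .
  qed
  define Q where "Q = l * (suminf b + 801 ^ CARD('n) * (2 * (a + suminf b)))"
  have partial: "(\<Sum>k<n. prob (B k \<union> C k)) \<le> Q" for n
  proof -
    have "(\<Sum>k<n. prob (B k \<union> C k)) \<le> (\<Sum>k<n. l * b k + 801 ^ CARD('n) * (l * h k))"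
      using B C by (intro sum_mono order_trans[OF measure_Un_le add_mono]) auto
    also have "\<dots> = l * ((\<Sum>k<n. b k) + 801 ^ CARD('n) * (\<Sum>k<n. h k))"
      by (simp add: sum.distrib sum_distrib_left sum_distrib_right algebra_simps)
    also have "\<dots> \<le> Q"
      unfolding Q_def h_def using summable b0 a0 l
      by (intro mult_left_mono add_mono sum_le_suminf sum_halving_sum_le) auto
    finally show ?thesis .
  qed
  have sm: "summable (\<lambda>k. prob (B k \<union> C k))"
    by (rule summableI_nonneg_bounded[OF _ partial]) simp
  have "prob (\<Union>k. B k \<union> C k) \<le> (\<Sum>k. prob (B k \<union> C k))"
    using sm by (intro finite_measure_subadditive_countably) auto
  also have "\<dots> \<le> Q" using sm partial by (rule suminf_le_const)
  finally have "prob A + prob (\<Union>k. B k \<union> C k) \<le> l * 16001 ^ CARD('n) + Q" using A by simp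
  moreover have "prob (A \<union> (\<Union>k. B k \<union> C k)) \<le> prob A + prob (\<Union>k. B k \<union> C k)"
    by (rule measure_Un_le) measurable
  ultimately show "prob {\<omega> \<in> space M. blocked (\<lambda>q. X q \<omega>)} \<le>
      l * (16001 ^ CARD('n) + suminf b + 801 ^ CARD('n) * (2 * (121 ^ CARD('n) + suminf b)))"
    unfolding bl Q_def a_def by (simp add: algebra_simps)
qed

section \<open>Summability of the tails over scales\<close>

text \<open>
  The largest term of the sum is less than \<open>t\<close> and a geometric sum is at most twice its largest term.
\<close>

lemma sum_powers_below:
  fixes a t :: real
  assumes a: "2 \<le> a" and t: "0 \<le> t"
  shows "(\<Sum>k<n. if a ^ k < t then a ^ k else 0) \<le> 2 * t"
proof (induction n)
  case (Suc n)
  have geom: "(\<Sum>k<m. a ^ k) \<le> a ^ m" for m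
  proof (induction m)
    case (Suc m)
    have "2 * a ^ m \<le> a * a ^ m" using a by (intro mult_right_mono) auto
    then show ?case using Suc by simp
  qed simp
  show ?case
  proof (cases "a ^ n < t")
    case True
    have "(\<Sum>k<n. if a ^ k < t then a ^ k else 0) \<le> (\<Sum>k<n. a ^ k)"
      using a by (intro sum_mono) auto
    then show ?thesis using geom[of n] True by simp
  next
    case False
    then show ?thesis using Suc by simp
  qed
qed (use t in simp)

text \<open>
  For a fixed radius \<open>r\<close> the sum of \<open>(20 ^ k) ^ d\<close> over the scales with \<open>20 ^ k < 8000 * r\<close> is of
  order \<open>r ^ d\<close>; integrating over \<open>r\<close> bounds the series of tails by the \<open>d\<close>-th moment.
\<close>

lemma summable_scaled_tails:
  fixes \<mu> :: "real measure"
  assumes \<mu>: "prob_space \<mu>" "sets \<mu> = sets borel" and pos: "AE r in \<mu>. 0 \<le> r"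
    and mom: "(\<integral>\<^sup>+ r. ennreal (r ^ d) \<partial>\<mu>) < \<infinity>" and d: "1 \<le> d"
  shows "summable (\<lambda>k. (121 * 20 ^ k) ^ d * measure \<mu> {20 ^ k / 8000<..})"
proof -
  interpret prob_space \<mu> by fact
  have meas [measurable]: "(\<lambda>r. r ^ d) \<in> borel_measurable \<mu>"
    unfolding measurable_cong_sets[OF \<mu>(2) refl] by measurable
  have sets [measurable]: "{t<..} \<in> sets \<mu>" for t using \<mu>(2) by simp
  have int: "integrable \<mu> (\<lambda>r. r ^ d)"
    using mom pos by (intro integrableI_nonneg) (auto elim!: eventually_mono)
  let ?g = "\<lambda>k r. (20 ^ d) ^ k * indicat_real {20 ^ k / 8000<..} r"
  show ?thesis
  proof (rule summableI_nonneg_bounded)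
    fix n
    have "(\<Sum>k<n. (121 * 20 ^ k) ^ d * measure \<mu> {20 ^ k / 8000<..})
        = 121 ^ d * (\<Sum>k<n. \<integral>r. ?g k r \<partial>\<mu>)"
      by (simp add: sum_distrib_left power_mult_distrib mult.assoc power_commutes flip: power_mult)
         (simp add: mult.commute)
    also have "(\<Sum>k<n. \<integral>r. ?g k r \<partial>\<mu>) = (\<integral>r. (\<Sum>k<n. ?g k r) \<partial>\<mu>)"
      by (rule Bochner_Integration.integral_sum[symmetric]) (auto simp: emeasure_eq_measure)
    also have "\<dots> \<le> (\<integral>r. 2 * 8000 ^ d * r ^ d \<partial>\<mu>)"
    proof (rule integral_mono_AE)
      show "integrable \<mu> (\<lambda>r. \<Sum>k<n. ?g k r)"
        by (intro Bochner_Integration.integrable_sum) (auto simp: emeasure_eq_measure)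
      show "integrable \<mu> (\<lambda>r. 2 * 8000 ^ d * r ^ d)" using int by simp
      show "AE r in \<mu>. (\<Sum>k<n. ?g k r) \<le> 2 * 8000 ^ d * r ^ d"
        using pos
      proof eventually_elim
        case (elim r)
        have 2: "(2::real) \<le> 20 ^ d" using power_increasing[of 1 d "20::real"] d by simp
        have "(\<Sum>k<n. ?g k r) \<le> (\<Sum>k<n. if (20 ^ d) ^ k < (8000 * r) ^ d then (20 ^ d) ^ k else 0)"
        proof (rule sum_mono)
          fix k
          have "(20 ^ d) ^ k < (8000 * r) ^ d" if "20 ^ k / 8000 < r"
          proof -
            have "(20 ^ k) ^ d < (8000 * r) ^ d" using that d by (intro power_strict_mono) auto
            then show ?thesis by (simp add: mult.commute flip: power_mult)
          qed
          then show "?g k r \<le> (if (20 ^ d) ^ k < (8000 * r) ^ d then (20 ^ d) ^ k else 0)"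
            by (auto simp: indicator_def)
        qed
        also have "\<dots> \<le> 2 * (8000 * r) ^ d" using 2 elim by (intro sum_powers_below) auto
        finally show ?case by (simp add: power_mult_distrib)
      qed
    qed
    finally show "(\<Sum>k<n. (121 * 20 ^ k) ^ d * measure \<mu> {20 ^ k / 8000<..})
        \<le> 121 ^ d * (\<integral>r. 2 * 8000 ^ d * r ^ d \<partial>\<mu>)" by simp
  qed simp
qed

section \<open>Positivity of the critical value\<close>

lemma not_AE_no_vacant_percolation:
  fixes Y :: "nat \<Rightarrow> 'w \<Rightarrow> real ^ 'n"
  assumes model: "spherical_boolean_model M l Y R \<mu>" and dim: "2 \<le> CARD('n)"
    and pos: "AE r in \<mu>. 0 \<le> r"
    and blocked: "measure M {\<omega> \<in> space M. blocked (\<lambda>q. cell_radius Y R q \<omega>)} < 1"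
      "Measurable.pred M (\<lambda>\<omega>. blocked (\<lambda>q. cell_radius Y R q \<omega>))"
  shows "\<not> (AE \<omega> in M. \<not> percolates (vacant_region Y R \<omega>))"
proof
  assume no: "AE \<omega> in M. \<not> percolates (vacant_region Y R \<omega>)"
  interpret spherical_boolean_model M l Y R \<mu> by fact
  have "AE \<omega> in M. 0 \<le> R k \<omega>" for k
  proof (rule AE_distrD[OF radii_measurable])
    show "AE r in distr M borel (R k). 0 \<le> r" using pos unfolding radii_distr .
  qed
  then have "AE \<omega> in M. \<forall>k. 0 \<le> R k \<omega>" by (simp add: AE_all_countable)
  with no locally_finite points_distinct have "AE \<omega> in M. blocked (\<lambda>q. cell_radius Y R q \<omega>)"
  proof eventually_elim
    case (elim \<omega>)
    let ?f = "\<lambda>q. cell_radius Y R q \<omega>"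
    show ?case
    proof (rule ccontr)
      assume nb: "\<not> blocked ?f"
      have "percolates (UNIV - (\<Union>k. cball (Y k \<omega>) (R k \<omega>)))"
      proof (rule vacant_percolates_if_no_crossing[where f = ?f, OF dim])
        fix B :: "(real ^ 'n) set" assume "bounded B"
        then have "finite (range (\<lambda>k. Y k \<omega>) \<inter> B)" using elim(2) by blast
        then have "finite ((\<lambda>k. Y k \<omega>) -` (range (\<lambda>k. Y k \<omega>) \<inter> B))"
          using elim(3) by (rule finite_vimageI)
        then show "finite {k. Y k \<omega> \<in> B}" by (simp add: vimage_def)
      next
        fix k
        show "0 \<le> R k \<omega>" using elim(4) by blast
        show "ereal (R k \<omega>) \<le> ?f (cell_of (Y k \<omega>))"
          using cell_radius_le_iff[of Y R "cell_of (Y k \<omega>)" \<omega> "?f (cell_of (Y k \<omega>))"] by simp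
      next
        fix q :: "'n \<Rightarrow> int" assume "ldist q (\<lambda>_. 0) \<le> 20 ^ 3"
        then show "?f q \<le> - 1" using nb by (auto simp: blocked_def one_ereal_def not_less)
      next
        fix k and q :: "'n \<Rightarrow> int" assume "3 \<le> k" "ldist q (\<lambda>_. 0) \<le> 20 ^ Suc k"
        then show "?f q \<le> ereal (20 ^ k / 8000)" using nb unfolding blocked_def by (meson mem_Collect_eq not_le)
      next
        fix k :: nat and c :: "'n \<Rightarrow> int" assume k: "1 \<le> k" and c: "c \<in> subgrid (\<lambda>_. 0) 400 (20 ^ k)"
        from k obtain m where "k = Suc m" by (cases k) auto
        then show "\<not> crossing ?f c (20 ^ k)" using nb c unfolding blocked_def by blast
      qed
      then show False using elim(1) by (simp add: vacant_region_def occupied_region_def)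
    qed
  qed
  then have "prob {\<omega> \<in> space M. blocked (\<lambda>q. cell_radius Y R q \<omega>)} = 1"
    using blocked(2) by (subst prob_Collect_eq_1) (auto simp: pred_def)
  with blocked(1) show False by simp
qed

theorem theorem2:
  fixes \<mu> :: "real measure"
    and N :: "'v measure" and \<rho> :: "'v \<Rightarrow> real"
    and M :: "real \<Rightarrow> 'w measure"
    and Y :: "real \<Rightarrow> nat \<Rightarrow> 'w \<Rightarrow> real ^ 'n"
    and R :: "real \<Rightarrow> nat \<Rightarrow> 'w \<Rightarrow> real"
  assumes "CARD('n) \<ge> 2"
    and "prob_space \<mu>" and "sets \<mu> = sets borel" and "AE r in \<mu>. 0 \<le> r"
    and "measure \<mu> {0} < 1"
    and "prob_space N" and "\<rho> \<in> borel_measurable N" and "distr N borel \<rho> = \<mu>"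
    and "(\<integral>\<^sup>+ \<omega>. ennreal (\<rho> \<omega> ^ CARD('n)) \<partial>N) < \<infinity>"
    and "\<And>l. 0 < l \<Longrightarrow> spherical_boolean_model (M l) l (Y l) (R l) \<mu>"
  shows "vacancy_critical_value M Y R > 0"
proof -
  define T where "T t = measure \<mu> {t<..}" for t
  define b where "b = (\<lambda>k. (121 * 20 ^ k) ^ CARD('n) * T (20 ^ k / 8000))"
  interpret \<mu>: prob_space \<mu> by fact
  have T: "0 \<le> T t" "T (- 1) \<le> 1" "antimono T" for t
    using \<open>sets \<mu> = sets borel\<close> by (auto simp: T_def intro!: antimonoI \<mu>.finite_measure_mono)
  have "(\<integral>\<^sup>+ r. ennreal (r ^ CARD('n)) \<partial>\<mu>) = (\<integral>\<^sup>+ \<omega>. ennreal (\<rho> \<omega> ^ CARD('n)) \<partial>N)"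
    unfolding \<open>distr N borel \<rho> = \<mu>\<close>[symmetric] using \<open>\<rho> \<in> borel_measurable N\<close> by (intro nn_integral_distr) auto
  then have b: "summable b"
    unfolding b_def T_def using assms by (intro summable_scaled_tails) auto
  have b0: "0 \<le> suminf b" using b T by (intro suminf_nonneg) (auto simp: b_def)
  define Q where "Q = 2 * (121 ^ CARD('n) + suminf b)"
  define K where "K = 16001 ^ CARD('n) + suminf b + 801 ^ CARD('n) * Q"
  define L where "L = 2 * ((75 ^ CARD('n))\<^sup>2 * Q) + 2 * K"
  have Q: "0 < Q" unfolding Q_def using b0 by (intro mult_pos_pos add_pos_nonneg) auto
  have K: "0 < K" unfolding K_def using Q b0 by (intro add_pos_nonneg) auto
  have L: "0 < L" unfolding L_def using Q K by (intro add_pos_pos) auto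
  have not_AE: "\<not> (AE \<omega> in M l. \<not> percolates (vacant_region (Y l) (R l) \<omega>))" if l: "0 < l" "l < 1 / L" for l
  proof -
    have model: "spherical_boolean_model (M l) l (Y l) (R l) \<mu>" using assms(10) l by blast
    interpret spherical_boolean_model "M l" l "Y l" "R l" \<mu> by (rule model)
    \<comment> \<open>\<open>L\<close> is chosen so that this single inequality yields both smallness conditions: the one that starts
      the multiscale recursion and the one that makes the blocking probability less than 1.\<close>
    have "l * L < 1" using l L by (simp add: field_simps)
    then have "2 * ((75 ^ CARD('n))\<^sup>2 * (l * Q)) + 2 * (l * K) < 1" by (simp add: L_def algebra_simps)
    moreover have "0 \<le> (75 ^ CARD('n))\<^sup>2 * (l * Q)" "0 \<le> l * K" using l Q K by simp_all
    ultimately have small: "(75 ^ CARD('n))\<^sup>2 * (l * Q) \<le> 1 / 2" "l * K < 1" by linarith+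
    note bound = prob_blocked[OF indep_vars_cell_radius[OF model], of l T]
    have tail: "prob {\<omega> \<in> space (M l). ereal t < cell_radius (Y l) (R l) q \<omega>} \<le> l * T t" for q t
      unfolding T_def using prob_cell_radius_greater[OF model] assms by blast
    have "prob {\<omega> \<in> space (M l). blocked (\<lambda>q. cell_radius (Y l) (R l) q \<omega>)} \<le> l * K"
      unfolding K_def Q_def b_def using l T tail b small(1) unfolding b_def Q_def by (intro bound) auto
    moreover have "Measurable.pred (M l) (\<lambda>\<omega>. blocked (\<lambda>q. cell_radius (Y l) (R l) q \<omega>))"
      using l T tail b small(1) unfolding b_def Q_def by (intro bound) auto
    ultimately show ?thesis
      using small(2) assms by (intro not_AE_no_vacant_percolation[OF model]) auto
  qed
  have "ereal (1 / L) \<le> vacancy_critical_value M Y R"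
    unfolding vacancy_critical_value_def
  proof (rule Inf_greatest)
    fix x assume "x \<in> {ereal l |l. 0 < l \<and> (AE \<omega> in M l. \<not> percolates (vacant_region (Y l) (R l) \<omega>))}"
    then obtain l where l: "x = ereal l" "0 < l" "AE \<omega> in M l. \<not> percolates (vacant_region (Y l) (R l) \<omega>)" by blast
    then show "ereal (1 / L) \<le> x" using not_AE[of l] by (cases "l < 1 / L") auto
  qed
  moreover have "0 < ereal (1 / L)" using L by simp
  ultimately show ?thesis by (rule less_le_trans[rotated])
qed

end
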